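(* Let $\mathsf{V}$ be the variety of Boolean algebras and their homomorphisms, and let $A$ be the Boolean algebra $\{0,1\}$. Then the functors $\mathcal{C}$ and $\mathcal{V}$ of the algebraic affine adjunction defined in the context form a contravariant equivalence between the category $\mathsf{V}_{\mathsf{p}}$ of presented Boolean algebras (which is equivalent to $\mathsf{V}$) and the category of closed subspaces of the generalised Cantor cubes $\{0,1\}^\mu$ ($\mu$ ranging over all cardinals, with the product topology of the discrete topology) with definable maps between them.
   Context: For a cardinal $\nu$, $\mathcal{F}(\nu)$ is the free $\mathsf{V}$-algebra on generators $X_\beta$, $\beta<\nu$. For $p\in\mathcal{F}(\nu)$ and $a=(a_\beta)_{\beta<\nu}\in A^\nu$, $\mathrm{ev}(p,a):=\widehat{a}(p)$, where $\widehat{a}\colon\mathcal{F}(\nu)\to A$ is the unique homomorphism with $X_\beta\mapsto a_\beta$. A homomorphism $h\colon\mathcal{F}(\mu)\to\mathcal{F}(\nu)$ induces the function $A^\nu\to A^\mu$, $a\mapsto(\mathrm{ev}(h(X_\beta),a))_{\beta<\mu}$; functions of this form are called definable. A definable map between subsets $S'\subseteq A^\nu$ and $S\subseteq A^\mu$ is a function $S'\to S$ that is the restriction of a definable function $A^\nu\to A^\mu$. $\mathsf{V}_{\mathsf{p}}$: objects are presentations $(\mathcal{F}(\mu),\theta)$, $\mu$ a cardinal and $\theta$ a congruence on $\mathcal{F}(\mu)$; morphisms $(\mathcal{F}(\mu),\theta)\to(\mathcal{F}(\nu),\theta')$ are the homomorphisms $\mathcal{F}(\mu)/\theta\to\mathcal{F}(\nu)/\theta'$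 (each induced by some homomorphism $\mathcal{F}(\mu)\to\mathcal{F}(\nu)$). $\mathsf{D}$: objects are subsets $S\subseteq A^\mu$, $\mu$ ranging over all cardinals, and arrows are definable maps. For $S\subseteq A^\mu$, $\mathbb{C}(S):=\{(p,q)\in\mathcal{F}(\mu)^2\mid\mathrm{ev}(p,a)=\mathrm{ev}(q,a)\ \forall a\in S\}$; for $R\subseteq\mathcal{F}(\mu)^2$, $\mathbb{V}(R):=\{a\in A^\mu\mid\mathrm{ev}(p,a)=\mathrm{ev}(q,a)\ \forall(p,q)\in R\}$. The functor $\mathcal{C}\colon\mathsf{D}\to\mathsf{V}_{\mathsf{p}}^{\rm op}$ sends $S\subseteq A^\mu$ to $(\mathcal{F}(\mu),\mathbb{C}(S))$ and a definable map from $S'\subseteq A^\nu$ to $S\subseteq A^\mu$ induced by $h\colon\mathcal{F}(\mu)\to\mathcal{F}(\nu)$ to the homomorphism $\mathcal{F}(\mu)/\mathbb{C}(S)\to\mathcal{F}(\nu)/\mathbb{C}(S')$ induced by $h$. The functor $\mathcal{V}\colon\mathsf{V}_{\mathsf{p}}^{\rm op}\to\mathsf{D}$ sends $(\mathcal{F}(\mu),\theta)$ to $\mathbb{V}(\theta)\subseteq A^\mu$ and a homomorphism $\mathcal{F}(\mu)/\theta\to\mathcal{F}(\nu)/\theta'$ induced by $h$ to the restriction $\mathbb{V}(\theta')\to\mathbb{V}(\theta)$ of the definable function induced by $h$. *)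

theory Defs
  imports "HOL-Analysis.Analysis" "HOL-Library.Equipollence" "HOL-Library.FuncSet"
begin

section \<open>Categories\<close>

text \<open>Hom-sets need not be disjoint, so composition takes the three objects as arguments:
  for f : X -> Y and g : Y -> Z, the composite "g after f" is \<open>Comp C X Y Z g f\<close>.\<close>

record ('o, 'm) precat =
  Ob :: "'o set"
  Hom :: "'o \<Rightarrow> 'o \<Rightarrow> 'm set"
  Idt :: "'o \<Rightarrow> 'm"
  Comp :: "'o \<Rightarrow> 'o \<Rightarrow> 'o \<Rightarrow> 'm \<Rightarrow> 'm \<Rightarrow> 'm"

definition category :: "('o, 'm) precat \<Rightarrow> bool" where
  "category C \<longleftrightarrow>
     (\<forall>X\<in>Ob C. Idt C X \<in> Hom C X X) \<and>
     (\<forall>X\<in>Ob C. \<forall>Y\<in>Ob C. \<forall>Z\<in>Ob C. \<forall>f\<in>Hom C X Y. \<forall>g\<in>Hom C Y Z.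
        Comp C X Y Z g f \<in> Hom C X Z) \<and>
     (\<forall>X\<in>Ob C. \<forall>Y\<in>Ob C. \<forall>f\<in>Hom C X Y.
        Comp C X X Y f (Idt C X) = f \<and> Comp C X Y Y (Idt C Y) f = f) \<and>
     (\<forall>W\<in>Ob C. \<forall>X\<in>Ob C. \<forall>Y\<in>Ob C. \<forall>Z\<in>Ob C.
        \<forall>f\<in>Hom C W X. \<forall>g\<in>Hom C X Y. \<forall>h\<in>Hom C Y Z.
          Comp C W Y Z h (Comp C W X Y g f) = Comp C W X Z (Comp C X Y Z h g) f)"

definition op_cat :: "('o, 'm) precat \<Rightarrow> ('o, 'm) precat" where
  "op_cat C = \<lparr>Ob = Ob C, Hom = (\<lambda>X Y. Hom C Y X), Idt = Idt C,
               Comp = (\<lambda>X Y Z g f. Comp C Z Y X f g)\<rparr>"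

definition full_subcat :: "('o, 'm) precat \<Rightarrow> ('o \<Rightarrow> bool) \<Rightarrow> ('o, 'm) precat" where
  "full_subcat C P = C\<lparr>Ob := {X \<in> Ob C. P X}\<rparr>"

definition iso_arrow :: "('o, 'm) precat \<Rightarrow> 'o \<Rightarrow> 'o \<Rightarrow> 'm \<Rightarrow> bool" where
  "iso_arrow C X Y f \<longleftrightarrow> f \<in> Hom C X Y \<and>
     (\<exists>g\<in>Hom C Y X. Comp C X Y X g f = Idt C X \<and> Comp C Y X Y f g = Idt C Y)"

text \<open>\<open>FArr F X Y f\<close> is the image of the arrow f : X -> Y.\<close>

record ('o, 'm, 'p, 'n) prefunctor =
  FOb :: "'o \<Rightarrow> 'p"
  FArr :: "'o \<Rightarrow> 'o \<Rightarrow> 'm \<Rightarrow> 'n"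

definition is_functor ::
  "('o, 'm) precat \<Rightarrow> ('p, 'n) precat \<Rightarrow> ('o, 'm, 'p, 'n) prefunctor \<Rightarrow> bool" where
  "is_functor C D F \<longleftrightarrow>
     (\<forall>X\<in>Ob C. FOb F X \<in> Ob D) \<and>
     (\<forall>X\<in>Ob C. \<forall>Y\<in>Ob C. \<forall>f\<in>Hom C X Y. FArr F X Y f \<in> Hom D (FOb F X) (FOb F Y)) \<and>
     (\<forall>X\<in>Ob C. FArr F X X (Idt C X) = Idt D (FOb F X)) \<and>
     (\<forall>X\<in>Ob C. \<forall>Y\<in>Ob C. \<forall>Z\<in>Ob C. \<forall>f\<in>Hom C X Y. \<forall>g\<in>Hom C Y Z.
        FArr F X Z (Comp C X Y Z g f) =
        Comp D (FOb F X) (FOb F Y) (FOb F Z) (FArr F Y Z g) (FArr F X Y f))"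

definition id_functor :: "('o, 'm, 'o, 'm) prefunctor" where
  "id_functor = \<lparr>FOb = (\<lambda>X. X), FArr = (\<lambda>X Y f. f)\<rparr>"

definition comp_functor ::
  "('p, 'n, 'q, 'k) prefunctor \<Rightarrow> ('o, 'm, 'p, 'n) prefunctor \<Rightarrow> ('o, 'm, 'q, 'k) prefunctor" where
  "comp_functor G F = \<lparr>FOb = (\<lambda>X. FOb G (FOb F X)),
                       FArr = (\<lambda>X Y f. FArr G (FOb F X) (FOb F Y) (FArr F X Y f))\<rparr>"

definition natural_iso ::
  "('o, 'm) precat \<Rightarrow> ('p, 'n) precat \<Rightarrow> ('o, 'm, 'p, 'n) prefunctor \<Rightarrow>
   ('o, 'm, 'p, 'n) prefunctor \<Rightarrow> ('o \<Rightarrow> 'n) \<Rightarrow> bool" where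
  "natural_iso C D F G \<eta> \<longleftrightarrow>
     (\<forall>X\<in>Ob C. iso_arrow D (FOb F X) (FOb G X) (\<eta> X)) \<and>
     (\<forall>X\<in>Ob C. \<forall>Y\<in>Ob C. \<forall>f\<in>Hom C X Y.
        Comp D (FOb F X) (FOb F Y) (FOb G Y) (\<eta> Y) (FArr F X Y f) =
        Comp D (FOb F X) (FOb G X) (FOb G Y) (FArr G X Y f) (\<eta> X))"

definition equivalence ::
  "('o, 'm) precat \<Rightarrow> ('p, 'n) precat \<Rightarrow> ('o, 'm, 'p, 'n) prefunctor \<Rightarrow>
   ('p, 'n, 'o, 'm) prefunctor \<Rightarrow> bool" where
  "equivalence C D F G \<longleftrightarrow>
     category C \<and> category D \<and> is_functor C D F \<and> is_functor D C G \<and>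
     (\<exists>\<eta>. natural_iso C C id_functor (comp_functor G F) \<eta>) \<and>
     (\<exists>\<epsilon>. natural_iso D D (comp_functor F G) id_functor \<epsilon>)"


section \<open>Boolean algebras\<close>

text \<open>Algebras for the signature of Boolean algebras, on an explicit carrier; the type class
  \<open>boolean_algebra\<close> does not apply, because the algebras below are quotients by congruences
  over which we quantify. The equations are those of the locale \<open>abstract_boolean_algebra\<close>.
  The one-element algebra is included.\<close>

record 'a balg =
  carrier :: "'a set"
  meet :: "'a \<Rightarrow> 'a \<Rightarrow> 'a"
  join :: "'a \<Rightarrow> 'a \<Rightarrow> 'a"
  neg :: "'a \<Rightarrow> 'a"
  bzero :: "'a"
  bone :: "'a"

definition boolean_alg :: "'a balg \<Rightarrow> bool" where
  "boolean_alg B \<longleftrightarrow>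
     bzero B \<in> carrier B \<and> bone B \<in> carrier B \<and>
     (\<forall>x\<in>carrier B. neg B x \<in> carrier B) \<and>
     (\<forall>x\<in>carrier B. \<forall>y\<in>carrier B. meet B x y \<in> carrier B \<and> join B x y \<in> carrier B) \<and>
     (\<forall>x\<in>carrier B. \<forall>y\<in>carrier B. \<forall>z\<in>carrier B.
        meet B (meet B x y) z = meet B x (meet B y z) \<and>
        join B (join B x y) z = join B x (join B y z) \<and>
        meet B x (join B y z) = join B (meet B x y) (meet B x z) \<and>
        join B x (meet B y z) = meet B (join B x y) (join B x z)) \<and>
     (\<forall>x\<in>carrier B. \<forall>y\<in>carrier B. meet B x y = meet B y x \<and> join B x y = join B y x) \<and>
     (\<forall>x\<in>carrier B. meet B x (bone B) = x \<and> join B x (bzero B) = x \<and>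
        meet B x (neg B x) = bzero B \<and> join B x (neg B x) = bone B)"

text \<open>Maps are extensional (\<open>undefined\<close> off their domain), so that equality of arrows is
  equality of maps on the domain.\<close>

definition balg_hom :: "'a balg \<Rightarrow> 'b balg \<Rightarrow> ('a \<Rightarrow> 'b) set" where
  "balg_hom B C = {h \<in> carrier B \<rightarrow>\<^sub>E carrier C.
     h (bzero B) = bzero C \<and> h (bone B) = bone C \<and>
     (\<forall>x\<in>carrier B. h (neg B x) = neg C (h x)) \<and>
     (\<forall>x\<in>carrier B. \<forall>y\<in>carrier B.
        h (meet B x y) = meet C (h x) (h y) \<and> h (join B x y) = join C (h x) (h y))}"

definition congruence :: "'a balg \<Rightarrow> ('a \<times> 'a) set \<Rightarrow> bool" where
  "congruence B \<theta> \<longleftrightarrow> equiv (carrier B) \<theta> \<and>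
     (\<forall>(x, x')\<in>\<theta>. (neg B x, neg B x') \<in> \<theta>) \<and>
     (\<forall>(x, x')\<in>\<theta>. \<forall>(y, y')\<in>\<theta>.
        (meet B x y, meet B x' y') \<in> \<theta> \<and> (join B x y, join B x' y') \<in> \<theta>)"

definition quot :: "'a balg \<Rightarrow> ('a \<times> 'a) set \<Rightarrow> 'a set balg" where
  "quot B \<theta> = \<lparr>carrier = carrier B // \<theta>,
     meet = (\<lambda>P Q. \<Union>x\<in>P. \<Union>y\<in>Q. \<theta> `` {meet B x y}),
     join = (\<lambda>P Q. \<Union>x\<in>P. \<Union>y\<in>Q. \<theta> `` {join B x y}),
     neg = (\<lambda>P. \<Union>x\<in>P. \<theta> `` {neg B x}),
     bzero = \<theta> `` {bzero B},
     bone = \<theta> `` {bone B}\<rparr>"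

definition two :: "bool balg" where
  "two = \<lparr>carrier = UNIV, meet = (\<and>), join = (\<or>), neg = Not, bzero = False, bone = True\<rparr>"


section \<open>Cardinals and free Boolean algebras\<close>

text \<open>The elements of a well-ordered type \<open>'i\<close> play the role of the ordinals (each is identified
  with the set \<open>{..<\<nu>}\<close> of its predecessors), and cardinals are initial ordinals. The type \<open>'i\<close>
  is arbitrary, so it bounds the cardinals considered but can be chosen with arbitrarily
  large order type.\<close>

definition is_cardinal :: "'i::wellorder \<Rightarrow> bool" where
  "is_cardinal \<nu> \<longleftrightarrow> (\<forall>\<beta><\<nu>. \<not> {..<\<beta>} \<approx> {..<\<nu>})"

datatype (vars: 'x) bterm =
  Var 'x | Zero | One | Neg "'x bterm" | Meet "'x bterm" "'x bterm" | Join "'x bterm" "'x bterm"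

definition term_alg :: "'i::wellorder \<Rightarrow> 'i bterm balg" where
  "term_alg \<nu> = \<lparr>carrier = {t. vars t \<subseteq> {..<\<nu>}},
     meet = Meet, join = Join, neg = Neg, bzero = Zero, bone = One\<rparr>"

text \<open>The free algebra of the variety is the term algebra modulo the least congruence whose
  quotient is a Boolean algebra.\<close>

definition free_cong :: "'i::wellorder \<Rightarrow> ('i bterm \<times> 'i bterm) set" where
  "free_cong \<nu> = {(s, t) \<in> carrier (term_alg \<nu>) \<times> carrier (term_alg \<nu>).
     \<forall>\<theta>. congruence (term_alg \<nu>) \<theta> \<and> boolean_alg (quot (term_alg \<nu>) \<theta>) \<longrightarrow> (s, t) \<in> \<theta>}"

definition free_alg :: "'i::wellorder \<Rightarrow> 'i bterm set balg" where
  "free_alg \<nu> = quot (term_alg \<nu>) (free_cong \<nu>)"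

definition gen :: "'i::wellorder \<Rightarrow> 'i \<Rightarrow> 'i bterm set" where
  "gen \<nu> \<beta> = free_cong \<nu> `` {Var \<beta>}"


section \<open>Evaluation and definable maps\<close>

definition cube :: "'i::wellorder \<Rightarrow> ('i \<Rightarrow> bool) set" where
  "cube \<nu> = {..<\<nu>} \<rightarrow>\<^sub>E carrier two"

definition cantor_top :: "'i::wellorder \<Rightarrow> ('i \<Rightarrow> bool) topology" where
  "cantor_top \<nu> = product_topology (\<lambda>_. discrete_topology (carrier two)) {..<\<nu>}"

definition ev_hom :: "'i::wellorder \<Rightarrow> ('i \<Rightarrow> bool) \<Rightarrow> 'i bterm set \<Rightarrow> bool" where
  "ev_hom \<nu> a = (THE h. h \<in> balg_hom (free_alg \<nu>) two \<and> (\<forall>\<beta><\<nu>. h (gen \<nu> \<beta>) = a \<beta>))"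

definition ev :: "'i::wellorder \<Rightarrow> 'i bterm set \<Rightarrow> ('i \<Rightarrow> bool) \<Rightarrow> bool" where
  "ev \<nu> p a = ev_hom \<nu> a p"

text \<open>For h : F(\<mu>) -> F(\<nu>), the induced definable function from the \<nu>-cube to the \<mu>-cube.\<close>

definition dfun :: "'i::wellorder \<Rightarrow> 'i \<Rightarrow> ('i bterm set \<Rightarrow> 'i bterm set) \<Rightarrow>
    ('i \<Rightarrow> bool) \<Rightarrow> 'i \<Rightarrow> bool" where
  "dfun \<mu> \<nu> h = (\<lambda>a\<in>cube \<nu>. \<lambda>\<beta>\<in>{..<\<mu>}. ev \<nu> (h (gen \<mu> \<beta>)) a)"

definition definable_maps :: "'i::wellorder \<times> ('i \<Rightarrow> bool) set \<Rightarrow> 'i \<times> ('i \<Rightarrow> bool) set \<Rightarrow>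
    (('i \<Rightarrow> bool) \<Rightarrow> 'i \<Rightarrow> bool) set" where
  "definable_maps = (\<lambda>(\<nu>, S') (\<mu>, S). {f \<in> S' \<rightarrow>\<^sub>E S.
     \<exists>h\<in>balg_hom (free_alg \<mu>) (free_alg \<nu>). f = restrict (dfun \<mu> \<nu> h) S'})"

definition CC :: "'i::wellorder \<Rightarrow> ('i \<Rightarrow> bool) set \<Rightarrow> ('i bterm set \<times> 'i bterm set) set" where
  "CC \<mu> S = {(p, q) \<in> carrier (free_alg \<mu>) \<times> carrier (free_alg \<mu>).
     \<forall>a\<in>S. ev \<mu> p a = ev \<mu> q a}"

definition VV :: "'i::wellorder \<Rightarrow> ('i bterm set \<times> 'i bterm set) set \<Rightarrow> ('i \<Rightarrow> bool) set" where
  "VV \<mu> R = {a \<in> cube \<mu>. \<forall>(p, q)\<in>R. ev \<mu> p a = ev \<mu> q a}"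


section \<open>The categories\<close>

text \<open>An object of D is a subset together with its ambient cube, which the empty subset does not
  determine.\<close>

definition D_cat ::
  "('i::wellorder \<times> ('i \<Rightarrow> bool) set, ('i \<Rightarrow> bool) \<Rightarrow> 'i \<Rightarrow> bool) precat" where
  "D_cat = \<lparr>Ob = {(\<mu>, S). is_cardinal \<mu> \<and> S \<subseteq> cube \<mu>},
     Hom = definable_maps,
     Idt = (\<lambda>X. \<lambda>a\<in>snd X. a),
     Comp = (\<lambda>X Y Z g f. compose (snd X) g f)\<rparr>"

definition closed_cat ::
  "('i::wellorder \<times> ('i \<Rightarrow> bool) set, ('i \<Rightarrow> bool) \<Rightarrow> 'i \<Rightarrow> bool) precat" where
  "closed_cat = full_subcat D_cat (\<lambda>(\<mu>, S). closedin (cantor_top \<mu>) S)"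

definition pres_alg ::
  "'i::wellorder \<times> ('i bterm set \<times> 'i bterm set) set \<Rightarrow> 'i bterm set set balg" where
  "pres_alg = (\<lambda>(\<mu>, \<theta>). quot (free_alg \<mu>) \<theta>)"

definition Vp_cat ::
  "('i::wellorder \<times> ('i bterm set \<times> 'i bterm set) set,
    'i bterm set set \<Rightarrow> 'i bterm set set) precat" where
  "Vp_cat = \<lparr>Ob = {(\<mu>, \<theta>). is_cardinal \<mu> \<and> congruence (free_alg \<mu>) \<theta>},
     Hom = (\<lambda>X Y. balg_hom (pres_alg X) (pres_alg Y)),
     Idt = (\<lambda>X. \<lambda>x\<in>carrier (pres_alg X). x),
     Comp = (\<lambda>X Y Z g f. compose (carrier (pres_alg X)) g f)\<rparr>"

text \<open>Boolean algebras of a size bounded by some ordinal of \<open>'i\<close>. The carriers are taken in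
  a type that contains those of all presented algebras and, since it is at least as large
  as \<open>'i\<close>, a copy of every Boolean algebra of such a size. When \<open>'i\<close> is infinite, every
  presented algebra satisfies the bound; for finite \<open>'i\<close> already the finite free algebras
  may exceed it.\<close>

definition BA_cat ::
  "('i::wellorder bterm set set balg, 'i bterm set set \<Rightarrow> 'i bterm set set) precat" where
  "BA_cat = \<lparr>Ob = {B. boolean_alg B \<and> (\<exists>\<nu>::'i. carrier B \<lesssim> {..<\<nu>})},
     Hom = balg_hom,
     Idt = (\<lambda>B. \<lambda>x\<in>carrier B. x),
     Comp = (\<lambda>B B' B'' g f. compose (carrier B) g f)\<rparr>"


section \<open>The functors\<close>

text \<open>For X = (\<mu>, \<theta>) and Y = (\<nu>, \<theta>'): the homomorphism g : F(\<mu>)/\<theta> -> F(\<nu>)/\<theta>' is induced by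
  h : F(\<mu>) -> F(\<nu>).\<close>

definition induced_by :: "'i::wellorder \<times> ('i bterm set \<times> 'i bterm set) set \<Rightarrow>
    'i \<times> ('i bterm set \<times> 'i bterm set) set \<Rightarrow> ('i bterm set \<Rightarrow> 'i bterm set) \<Rightarrow>
    ('i bterm set set \<Rightarrow> 'i bterm set set) \<Rightarrow> bool" where
  "induced_by X Y h g \<longleftrightarrow>
     h \<in> balg_hom (free_alg (fst X)) (free_alg (fst Y)) \<and>
     g \<in> balg_hom (pres_alg X) (pres_alg Y) \<and>
     (\<forall>p\<in>carrier (free_alg (fst X)). g (snd X `` {p}) = snd Y `` {h p})"

definition C_ob :: "'i::wellorder \<times> ('i \<Rightarrow> bool) set \<Rightarrow> 'i \<times> ('i bterm set \<times> 'i bterm set) set" where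
  "C_ob = (\<lambda>(\<mu>, S). (\<mu>, CC \<mu> S))"

definition V_ob :: "'i::wellorder \<times> ('i bterm set \<times> 'i bterm set) set \<Rightarrow> 'i \<times> ('i \<Rightarrow> bool) set" where
  "V_ob = (\<lambda>(\<mu>, \<theta>). (\<mu>, VV \<mu> \<theta>))"

text \<open>The description operator takes the one arrow obtained from all inducing h alike.
  An arrow f : X -> Y of D goes to a homomorphism from the algebra of Y to that of X;
  an arrow Y -> X of the opposite of V_p is a homomorphism g from the algebra of X to
  that of Y.\<close>

definition C_functor ::
  "('i::wellorder \<times> ('i \<Rightarrow> bool) set, ('i \<Rightarrow> bool) \<Rightarrow> 'i \<Rightarrow> bool,
    'i \<times> ('i bterm set \<times> 'i bterm set) set, 'i bterm set set \<Rightarrow> 'i bterm set set) prefunctor" where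
  "C_functor = \<lparr>FOb = C_ob,
     FArr = (\<lambda>X Y f. THE g. \<exists>h\<in>balg_hom (free_alg (fst Y)) (free_alg (fst X)).
       f = restrict (dfun (fst Y) (fst X) h) (snd X) \<and> induced_by (C_ob Y) (C_ob X) h g)\<rparr>"

definition V_functor ::
  "('i::wellorder \<times> ('i bterm set \<times> 'i bterm set) set, 'i bterm set set \<Rightarrow> 'i bterm set set,
    'i \<times> ('i \<Rightarrow> bool) set, ('i \<Rightarrow> bool) \<Rightarrow> 'i \<Rightarrow> bool) prefunctor" where
  "V_functor = \<lparr>FOb = V_ob,
     FArr = (\<lambda>Y X g. THE f. \<exists>h\<in>balg_hom (free_alg (fst X)) (free_alg (fst Y)).
       induced_by X Y h g \<and> f = restrict (dfun (fst X) (fst Y) h) (snd (V_ob Y)))\<rparr>"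

end

theory Submission
  imports Defs
begin

text \<open>The Galois connection between congruences and subsets of a cube is a bijection between all
  congruences and the closed subsets. On the algebraic side this is the Boolean prime ideal
  theorem: homomorphisms to \<open>two\<close> separate the elements of the quotient by \<open>\<theta>\<close>, and a homomorphism
  from that quotient is a point of \<open>VV \<mu> \<theta>\<close>. On the topological side, the clopen sets defined by
  terms form a basis of the cube. As both functors are given on arrows by the same homomorphism
  of free algebras, they are then inverse to each other on the nose. For the equivalence
  with all Boolean algebras of bounded size, such an algebra is generated by its own elements,
  and over an infinite set of variables there are no more terms than variables.\<close>

section \<open>Quotients and homomorphisms\<close>

text \<open>A definable map, like a homomorphism of presented algebras, has many inducing
  \<open>h\<close>, and both functors are given by descriptions; so the two ways of identifying such
  \<open>h\<close> have to be matched. Two \<open>h\<close> with the same restriction to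
  \<open>S\<close> send every \<open>p\<close> to elements with equal values on \<open>S\<close>,
  hence congruent modulo \<open>CC\<close>. Two \<open>h\<close> inducing the same homomorphism send
  generators to congruent elements, hence give equal coordinates on \<open>VV\<close>. Both functors
  rest on one substitution identity, \<open>ev_hom_apply\<close>: evaluating \<open>h p\<close> at
  \<open>a\<close> is evaluating \<open>p\<close> at the image of \<open>a\<close>.

  The free algebra is a quotient of a term algebra that is itself not Boolean. Quotients are
  therefore developed for algebras that are merely closed under their operations, with laws stated
  modulo a relation.

  The size comparison splits into two cases: even over finitely many variables there are infinitely
  many terms, so a free algebra on finitely many generators is counted through truth tables
  instead.\<close>

definition op_closed :: "'a balg \<Rightarrow> bool" where
  "op_closed A \<longleftrightarrow> bzero A \<in> carrier A \<and> bone A \<in> carrier A \<and>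
     (\<forall>x\<in>carrier A. neg A x \<in> carrier A) \<and>
     (\<forall>x\<in>carrier A. \<forall>y\<in>carrier A. meet A x y \<in> carrier A \<and> join A x y \<in> carrier A)"

lemma op_closedD:
  assumes "op_closed A"
  shows "bzero A \<in> carrier A" "bone A \<in> carrier A"
    "\<And>x. x \<in> carrier A \<Longrightarrow> neg A x \<in> carrier A"
    "\<And>x y. x \<in> carrier A \<Longrightarrow> y \<in> carrier A \<Longrightarrow> meet A x y \<in> carrier A"
    "\<And>x y. x \<in> carrier A \<Longrightarrow> y \<in> carrier A \<Longrightarrow> join A x y \<in> carrier A"
  using assms by (auto simp: op_closed_def)

text \<open>For \<open>R = Id\<close> these are the Boolean equations in \<open>A\<close>; for a
  congruence they are the equations of the quotient, read on representatives. Term algebras satisfy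
  them only in the second sense.\<close>

definition boolean_laws :: "'a balg \<Rightarrow> ('a \<times> 'a) set \<Rightarrow> bool" where
  "boolean_laws A R \<longleftrightarrow>
     (\<forall>x\<in>carrier A. \<forall>y\<in>carrier A. \<forall>z\<in>carrier A.
        (meet A (meet A x y) z, meet A x (meet A y z)) \<in> R \<and>
        (join A (join A x y) z, join A x (join A y z)) \<in> R \<and>
        (meet A x (join A y z), join A (meet A x y) (meet A x z)) \<in> R \<and>
        (join A x (meet A y z), meet A (join A x y) (join A x z)) \<in> R) \<and>
     (\<forall>x\<in>carrier A. \<forall>y\<in>carrier A.
        (meet A x y, meet A y x) \<in> R \<and> (join A x y, join A y x) \<in> R) \<and>
     (\<forall>x\<in>carrier A. (meet A x (bone A), x) \<in> R \<and> (join A x (bzero A), x) \<in> R \<and>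
        (meet A x (neg A x), bzero A) \<in> R \<and> (join A x (neg A x), bone A) \<in> R)"

lemma boolean_laws_mono: "boolean_laws A R \<Longrightarrow> R \<subseteq> R' \<Longrightarrow> boolean_laws A R'"
  unfolding boolean_laws_def by blast

text \<open>A congruence contains only the part of \<open>Id\<close> over the carrier. Closure keeps
  both sides of every law in the carrier, so \<open>R\<close> may be cut down accordingly.\<close>

lemma boolean_laws_restrict:
  assumes "op_closed A" "boolean_laws A R"
  shows "boolean_laws A (R \<inter> carrier A \<times> carrier A)"
  using assms(2) op_closedD[OF assms(1)] by (simp add: boolean_laws_def)

lemma boolean_alg_iff: "boolean_alg A \<longleftrightarrow> op_closed A \<and> boolean_laws A Id"
  unfolding boolean_alg_def boolean_laws_def op_closed_def by auto

lemma boolean_alg_op_closed: "boolean_alg A \<Longrightarrow> op_closed A"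
  by (simp add: boolean_alg_iff)

context
  fixes A :: "'a balg" and \<theta> :: "('a \<times> 'a) set"
  assumes cong: "congruence A \<theta>"
begin

lemma congruence_equiv: "equiv (carrier A) \<theta>"
  using cong by (simp add: congruence_def)

lemma congruence_refl: "x \<in> carrier A \<Longrightarrow> (x, x) \<in> \<theta>"
  using congruence_equiv by (meson equivE refl_onD)

lemma congruence_sym: "(x, y) \<in> \<theta> \<Longrightarrow> (y, x) \<in> \<theta>"
  using congruence_equiv by (meson equivE symD)

lemma congruence_trans: "(x, y) \<in> \<theta> \<Longrightarrow> (y, z) \<in> \<theta> \<Longrightarrow> (x, z) \<in> \<theta>"
  using congruence_equiv by (meson equivE transD)

lemma congruence_carrier:
  assumes "(x, y) \<in> \<theta>" shows "x \<in> carrier A" "y \<in> carrier A"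
  using congruence_equiv assms by (auto elim!: equivE)

lemma congruence_neg: "(x, x') \<in> \<theta> \<Longrightarrow> (neg A x, neg A x') \<in> \<theta>"
  using cong by (auto simp: congruence_def)

lemma congruence_meet: "(x, x') \<in> \<theta> \<Longrightarrow> (y, y') \<in> \<theta> \<Longrightarrow> (meet A x y, meet A x' y') \<in> \<theta>"
  and congruence_join: "(x, x') \<in> \<theta> \<Longrightarrow> (y, y') \<in> \<theta> \<Longrightarrow> (join A x y, join A x' y') \<in> \<theta>"
  using cong by (fastforce simp: congruence_def)+

lemma class_eq_iff:
  "x \<in> carrier A \<Longrightarrow> y \<in> carrier A \<Longrightarrow> \<theta> `` {x} = \<theta> `` {y} \<longleftrightarrow> (x, y) \<in> \<theta>"
  using congruence_equiv by (rule eq_equiv_class_iff)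

lemma class_eqI: "(x, y) \<in> \<theta> \<Longrightarrow> \<theta> `` {x} = \<theta> `` {y}"
  using class_eq_iff congruence_carrier by blast

lemma quot_neg:
  assumes "x \<in> carrier A" shows "neg (quot A \<theta>) (\<theta> `` {x}) = \<theta> `` {neg A x}"
proof -
  have neg: "(\<lambda>x. \<theta> `` {neg A x}) respects \<theta>"
    by (intro congruentI class_eqI congruence_neg)
  show ?thesis
    using UN_equiv_class[OF congruence_equiv neg assms] by (simp add: quot_def)
qed

lemma
  assumes "x \<in> carrier A" "y \<in> carrier A"
  shows quot_meet: "meet (quot A \<theta>) (\<theta> `` {x}) (\<theta> `` {y}) = \<theta> `` {meet A x y}"
    and quot_join: "join (quot A \<theta>) (\<theta> `` {x}) (\<theta> `` {y}) = \<theta> `` {join A x y}"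
proof -
  have meet: "(\<lambda>x y. \<theta> `` {meet A x y}) respects2 \<theta>"
    by (intro congruent2I' class_eqI congruence_meet)
  have join: "(\<lambda>x y. \<theta> `` {join A x y}) respects2 \<theta>"
    by (intro congruent2I' class_eqI congruence_join)
  show "meet (quot A \<theta>) (\<theta> `` {x}) (\<theta> `` {y}) = \<theta> `` {meet A x y}"
    using UN_equiv_class2[OF congruence_equiv congruence_equiv meet assms] by (simp add: quot_def)
  show "join (quot A \<theta>) (\<theta> `` {x}) (\<theta> `` {y}) = \<theta> `` {join A x y}"
    using UN_equiv_class2[OF congruence_equiv congruence_equiv join assms] by (simp add: quot_def)
qed

lemma quot_zero: "bzero (quot A \<theta>) = \<theta> `` {bzero A}"
  and quot_one: "bone (quot A \<theta>) = \<theta> `` {bone A}"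
  by (simp_all add: quot_def)

lemma class_in_quot: "x \<in> carrier A \<Longrightarrow> \<theta> `` {x} \<in> carrier (quot A \<theta>)"
  by (simp add: quot_def quotientI)

lemma ball_quot: "(\<forall>P\<in>carrier (quot A \<theta>). \<Phi> P) \<longleftrightarrow> (\<forall>x\<in>carrier A. \<Phi> (\<theta> `` {x}))"
  by (auto simp: quot_def quotient_def)

text \<open>Equality of classes is membership in \<theta>, and by \<open>ball_quot\<close>
  quantifying over classes is quantifying over representatives. With \<open>A\<close> only closed
  under its operations, this covers the term algebra.\<close>

lemma boolean_alg_quot_iff:
  assumes cl: "op_closed A"
  shows "boolean_alg (quot A \<theta>) \<longleftrightarrow> boolean_laws A \<theta>"
proof -
  note [simp] = op_closedD[OF cl] quot_neg quot_meet quot_join quot_zero quot_one class_in_quot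
    class_eq_iff ball_quot
  have "op_closed (quot A \<theta>)"
    unfolding op_closed_def by simp
  moreover have "boolean_laws (quot A \<theta>) Id \<longleftrightarrow> boolean_laws A \<theta>"
    unfolding boolean_laws_def by simp
  ultimately show ?thesis
    by (simp add: boolean_alg_iff)
qed

lemma boolean_alg_quot:
  assumes "boolean_alg A" shows "boolean_alg (quot A \<theta>)"
proof -
  have cl: "op_closed A" and laws: "boolean_laws A Id"
    using assms by (simp_all add: boolean_alg_iff)
  have "Id \<inter> carrier A \<times> carrier A \<subseteq> \<theta>"
    using congruence_refl by auto
  then have "boolean_laws A \<theta>"
    using boolean_laws_restrict[OF cl laws] boolean_laws_mono by blast
  then show ?thesis
    using boolean_alg_quot_iff cl by blast
qed

end

section \<open>Homomorphisms, kernels and maps out of quotients\<close>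

lemma balg_homD:
  assumes "h \<in> balg_hom B C"
  shows "\<And>x. x \<in> carrier B \<Longrightarrow> h x \<in> carrier C"
    "h (bzero B) = bzero C" "h (bone B) = bone C"
    "\<And>x. x \<in> carrier B \<Longrightarrow> h (neg B x) = neg C (h x)"
    "\<And>x y. x \<in> carrier B \<Longrightarrow> y \<in> carrier B \<Longrightarrow> h (meet B x y) = meet C (h x) (h y)"
    "\<And>x y. x \<in> carrier B \<Longrightarrow> y \<in> carrier B \<Longrightarrow> h (join B x y) = join C (h x) (h y)"
    "h \<in> extensional (carrier B)"
  using assms by (auto simp: balg_hom_def PiE_def)

lemma balg_homI:
  assumes "\<And>x. x \<in> carrier B \<Longrightarrow> h x \<in> carrier C"
    "h (bzero B) = bzero C" "h (bone B) = bone C"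
    "\<And>x. x \<in> carrier B \<Longrightarrow> h (neg B x) = neg C (h x)"
    "\<And>x y. x \<in> carrier B \<Longrightarrow> y \<in> carrier B \<Longrightarrow> h (meet B x y) = meet C (h x) (h y)"
    "\<And>x y. x \<in> carrier B \<Longrightarrow> y \<in> carrier B \<Longrightarrow> h (join B x y) = join C (h x) (h y)"
    "h \<in> extensional (carrier B)"
  shows "h \<in> balg_hom B C"
  using assms by (auto simp: balg_hom_def PiE_def)

lemma balg_hom_eqI:
  assumes "g \<in> balg_hom B C" "h \<in> balg_hom B C" "\<And>x. x \<in> carrier B \<Longrightarrow> g x = h x"
  shows "g = h"
  using assms(3) extensionalityI[OF balg_homD(7)[OF assms(1)] balg_homD(7)[OF assms(2)]] by blast

lemma balg_hom_id: "op_closed B \<Longrightarrow> (\<lambda>x\<in>carrier B. x) \<in> balg_hom B B"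
  by (rule balg_homI) (simp_all add: op_closedD)

lemma balg_hom_compose:
  assumes cl: "op_closed A" and h: "h \<in> balg_hom A B" and g: "g \<in> balg_hom B C"
  shows "compose (carrier A) g h \<in> balg_hom A C"
  using balg_homD[OF h] balg_homD[OF g] op_closedD[OF cl]
  by (intro balg_homI) (simp_all add: compose_eq)

lemma balg_hom_class:
  assumes "op_closed A" "congruence A \<theta>"
  shows "(\<lambda>x\<in>carrier A. \<theta> `` {x}) \<in> balg_hom A (quot A \<theta>)"
  using assms op_closedD[OF assms(1)]
  by (intro balg_homI)
    (simp_all add: class_in_quot quot_zero quot_one quot_neg quot_meet quot_join)

definition ker :: "'a balg \<Rightarrow> ('a \<Rightarrow> 'b) \<Rightarrow> ('a \<times> 'a) set" where
  "ker A h = {(x, y) \<in> carrier A \<times> carrier A. h x = h y}"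

lemma congruence_ker:
  assumes "op_closed A" "h \<in> balg_hom A B"
  shows "congruence A (ker A h)"
proof -
  have "equiv (carrier A) (ker A h)"
    by (rule equivI) (auto simp: ker_def refl_on_def sym_def trans_def)
  then show ?thesis
    using op_closedD[OF assms(1)] balg_homD[OF assms(2)]
    by (auto simp: congruence_def ker_def)
qed

lemma boolean_laws_ker:
  assumes "op_closed A" "h \<in> balg_hom A B" "boolean_alg B"
  shows "boolean_laws A (ker A h)"
proof -
  \<comment> \<open>Equality of images is kept as membership in \<open>Id\<close>, so that the goal
    has the same shape as the laws of \<open>B\<close>; hence \<open>pair_in_Id_conv\<close> must
    not fire below.\<close>
  have ker: "(x, y) \<in> ker A h \<longleftrightarrow> x \<in> carrier A \<and> y \<in> carrier A \<and> (h x, h y) \<in> Id" for x y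
    by (simp add: ker_def)
  have "boolean_laws B Id"
    using assms(3) by (simp add: boolean_alg_iff)
  then show ?thesis
    using op_closedD[OF assms(1)] balg_homD[OF assms(2)]
    by (simp add: boolean_laws_def ker del: pair_in_Id_conv)
qed

text \<open>The map given by the homomorphism theorem. Its value is read off a chosen
  representative; by \<open>factor_class\<close> the choice does not matter once \<theta> lies in
  the kernel of \<open>h\<close>.\<close>

definition factor :: "'a balg \<Rightarrow> ('a \<times> 'a) set \<Rightarrow> ('a \<Rightarrow> 'b) \<Rightarrow> 'a set \<Rightarrow> 'b" where
  "factor A \<theta> h = (\<lambda>P\<in>carrier (quot A \<theta>). h (SOME x. x \<in> P))"

context
  fixes A :: "'a balg" and \<theta> and h :: "'a \<Rightarrow> 'b" and B
  assumes cl: "op_closed A" and cong: "congruence A \<theta>" and hom: "h \<in> balg_hom A B"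
    and le: "\<theta> \<subseteq> ker A h"
begin

lemma factor_class:
  assumes "x \<in> carrier A" shows "factor A \<theta> h (\<theta> `` {x}) = h x"
proof -
  have "(SOME y. y \<in> \<theta> `` {x}) \<in> \<theta> `` {x}"
    using congruence_refl[OF cong assms] by (intro someI) simp
  then have "h (SOME y. y \<in> \<theta> `` {x}) = h x"
    using le by (auto simp: ker_def)
  then show ?thesis
    using class_in_quot[OF cong assms] by (simp add: factor_def)
qed

lemma factor_hom: "factor A \<theta> h \<in> balg_hom (quot A \<theta>) B"
proof -
  note [simp] = factor_class balg_homD[OF hom] op_closedD[OF cl] quot_neg[OF cong]
    quot_meet[OF cong] quot_join[OF cong] quot_zero[OF cong] quot_one[OF cong]
  have "\<forall>P\<in>carrier (quot A \<theta>). factor A \<theta> h P \<in> carrier B \<and>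
      factor A \<theta> h (neg (quot A \<theta>) P) = neg B (factor A \<theta> h P) \<and>
      (\<forall>Q\<in>carrier (quot A \<theta>).
        factor A \<theta> h (meet (quot A \<theta>) P Q) = meet B (factor A \<theta> h P) (factor A \<theta> h Q) \<and>
        factor A \<theta> h (join (quot A \<theta>) P Q) = join B (factor A \<theta> h P) (factor A \<theta> h Q))"
    unfolding ball_quot[OF cong] by simp
  moreover have "factor A \<theta> h \<in> extensional (carrier (quot A \<theta>))"
    by (simp add: factor_def)
  ultimately show ?thesis
    by (intro balg_homI) simp_all
qed

end

lemma balg_hom_quot_eqI:
  assumes "congruence A \<theta>" "g \<in> balg_hom (quot A \<theta>) B" "g' \<in> balg_hom (quot A \<theta>) B"
    and "\<And>x. x \<in> carrier A \<Longrightarrow> g (\<theta> `` {x}) = g' (\<theta> `` {x})"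
  shows "g = g'"
proof -
  have "\<forall>P\<in>carrier (quot A \<theta>). g P = g' P"
    unfolding ball_quot[OF assms(1)] using assms(4) by blast
  then show ?thesis
    using balg_hom_eqI assms(2,3) by blast
qed

section \<open>Separation of elements by homomorphisms to two\<close>

lemma boolean_alg_two: "boolean_alg two"
  by (auto simp: boolean_alg_def two_def)

locale boolean_algebra_on =
  fixes B :: "'a balg"
  assumes boolean: "boolean_alg B"
begin

abbreviation meet' (infixl "\<sqinter>" 70) where "x \<sqinter> y \<equiv> meet B x y"
abbreviation join' (infixl "\<squnion>" 65) where "x \<squnion> y \<equiv> join B x y"
abbreviation zero' ("\<bottom>") where "\<bottom> \<equiv> bzero B"
abbreviation one' ("\<top>") where "\<top> \<equiv> bone B"

lemmas closed [simp] = op_closedD[OF boolean_alg_op_closed[OF boolean]]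

lemma laws:
  assumes "x \<in> carrier B" "y \<in> carrier B" "z \<in> carrier B"
  shows meet_assoc: "x \<sqinter> y \<sqinter> z = x \<sqinter> (y \<sqinter> z)"
    and meet_join: "x \<sqinter> (y \<squnion> z) = x \<sqinter> y \<squnion> x \<sqinter> z"
    and join_meet: "x \<squnion> (y \<sqinter> z) = (x \<squnion> y) \<sqinter> (x \<squnion> z)"
  using boolean assms unfolding boolean_alg_def by blast+

lemma comm:
  assumes "x \<in> carrier B" "y \<in> carrier B"
  shows meet_comm: "x \<sqinter> y = y \<sqinter> x" and join_comm: "x \<squnion> y = y \<squnion> x"
  using boolean assms unfolding boolean_alg_def by blast+

lemma units [simp]:
  assumes "x \<in> carrier B"
  shows meet_one: "x \<sqinter> \<top> = x" and join_zero: "x \<squnion> \<bottom> = x"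
    and meet_neg: "x \<sqinter> neg B x = \<bottom>" and join_neg: "x \<squnion> neg B x = \<top>"
  using boolean assms unfolding boolean_alg_def by blast+

lemma meet_idem [simp]:
  assumes "x \<in> carrier B" shows "x \<sqinter> x = x"
  using meet_join[of x x "neg B x"] assms by simp

lemma join_one [simp]:
  assumes "x \<in> carrier B" shows "x \<squnion> \<top> = \<top>"
  using join_meet[of x "neg B x" \<top>] meet_comm[of \<top> "x \<squnion> \<top>"] assms by simp

lemma meet_zero [simp]:
  assumes "x \<in> carrier B" shows "x \<sqinter> \<bottom> = \<bottom>"
  using meet_assoc[of x x "neg B x"] assms by simp

lemma join_absorb [simp]:
  assumes "x \<in> carrier B" "y \<in> carrier B" shows "x \<squnion> x \<sqinter> y = x"
  using meet_join[of x \<top> y] join_comm[of \<top> y] assms by simp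

lemma meet_left_comm:
  assumes "x \<in> carrier B" "y \<in> carrier B" "z \<in> carrier B"
  shows "x \<sqinter> (y \<sqinter> z) = y \<sqinter> (x \<sqinter> z)"
  using meet_assoc[of x y z] meet_assoc[of y x z] meet_comm[of x y] assms by simp

lemma meet_left_idem [simp]:
  assumes "x \<in> carrier B" "y \<in> carrier B" shows "x \<sqinter> (x \<sqinter> y) = x \<sqinter> y"
  using meet_assoc[of x x y] assms by simp

lemmas ac = meet_assoc meet_left_comm meet_comm

text \<open>No order is defined on \<open>carrier B\<close>, so upward closure is encoded as closure
  under joins with arbitrary elements; \<open>filter_upward\<close> recovers the usual form.\<close>

definition proper_filters :: "'a set set" where
  "proper_filters = {F. F \<subseteq> carrier B \<and> \<top> \<in> F \<and> \<bottom> \<notin> F \<and>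
     (\<forall>x\<in>F. \<forall>y\<in>F. x \<sqinter> y \<in> F) \<and> (\<forall>x\<in>F. \<forall>y\<in>carrier B. x \<squnion> y \<in> F)}"

lemma filter_upward:
  assumes "F \<in> proper_filters" "x \<in> F" "y \<in> carrier B" "x \<sqinter> y = x"
  shows "y \<in> F"
proof -
  have "x \<in> carrier B" "x \<squnion> y \<in> F"
    using assms by (auto simp: proper_filters_def)
  moreover have "x \<squnion> y = y"
    using assms(3,4) \<open>x \<in> carrier B\<close> meet_comm[of x y] join_comm[of x y] join_absorb[of y x] by simp
  ultimately show ?thesis by simp
qed

text \<open>The witness \<open>?G\<close> is the filter generated by \<open>F\<close> and
  \<open>x\<close>: the elements above some \<open>f \<sqinter> x\<close>, where \<open>u\<close>
  being above \<open>v\<close> is written \<open>v \<sqinter> u = v\<close>. It omits \<bottom>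
  because no \<open>f \<sqinter> x\<close> is \<bottom>.\<close>

lemma filter_adjoin:
  assumes F: "F \<in> proper_filters" and x: "x \<in> carrier B" and nz: "\<forall>f\<in>F. f \<sqinter> x \<noteq> \<bottom>"
  shows "\<exists>G\<in>proper_filters. F \<subseteq> G \<and> x \<in> G"
proof
  have FB: "F \<subseteq> carrier B" and one: "\<top> \<in> F" and FM: "\<And>f g. f \<in> F \<Longrightarrow> g \<in> F \<Longrightarrow> f \<sqinter> g \<in> F"
    using F by (auto simp: proper_filters_def)
  let ?G = "{u \<in> carrier B. \<exists>f\<in>F. f \<sqinter> x \<sqinter> u = f \<sqinter> x}"
  have "f \<sqinter> x \<sqinter> \<bottom> = \<bottom>" if "f \<in> F" for f
    using FB x that by (intro meet_zero closed) auto
  then have "\<bottom> \<notin> ?G"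
    using nz by auto
  moreover have "u \<sqinter> v \<in> ?G" if "u \<in> ?G" "v \<in> ?G" for u v
  proof -
    from that obtain f g where fg: "f \<in> F" "f \<sqinter> x \<sqinter> u = f \<sqinter> x" "g \<in> F" "g \<sqinter> x \<sqinter> v = g \<sqinter> x"
      by auto
    have c: "f \<in> carrier B" "g \<in> carrier B" "u \<in> carrier B" "v \<in> carrier B"
      using fg FB that by auto
    have "f \<sqinter> g \<sqinter> x \<sqinter> (u \<sqinter> v) = (f \<sqinter> x \<sqinter> u) \<sqinter> (g \<sqinter> x \<sqinter> v)"
      using c x by (simp add: ac)
    also have "\<dots> = f \<sqinter> g \<sqinter> x"
      unfolding fg using c x by (simp add: ac)
    finally show ?thesis
      using FM[OF fg(1,3)] c by auto
  qed
  moreover have "u \<squnion> v \<in> ?G" if "u \<in> ?G" "v \<in> carrier B" for u v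
  proof -
    from that obtain f where f: "f \<in> F" "f \<sqinter> x \<sqinter> u = f \<sqinter> x" by auto
    have "f \<sqinter> x \<sqinter> (u \<squnion> v) = f \<sqinter> x"
      using f FB x that by (subst meet_join) auto
    then show ?thesis using f that by auto
  qed
  moreover have "\<top> \<in> ?G"
    using x one by (auto intro!: bexI[of _ \<top>])
  ultimately show "?G \<in> proper_filters"
    by (simp add: proper_filters_def)
  have "f \<in> ?G" if "f \<in> F" for f
  proof -
    have "f \<sqinter> x \<sqinter> f = f \<sqinter> x"
      using subsetD[OF FB that] x by (simp add: ac)
    then show ?thesis using that FB by blast
  qed
  moreover have "x \<in> ?G"
    using x one FB by (auto intro!: bexI[of _ \<top>] simp: meet_assoc)
  ultimately show "F \<subseteq> ?G \<and> x \<in> ?G" by blast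
qed

lemma ultrafilter_exists:
  assumes "x \<in> carrier B" "x \<noteq> \<bottom>"
  obtains U where "U \<in> proper_filters" "x \<in> U" "\<And>F. F \<in> proper_filters \<Longrightarrow> U \<subseteq> F \<Longrightarrow> F = U"
proof -
  have "\<top> \<noteq> \<bottom>"
    using assms meet_one[of x] meet_zero[of x] by metis
  then have "{\<top>} \<in> proper_filters"
    using join_comm[of \<top>] by (simp add: proper_filters_def)
  moreover have "\<forall>f\<in>{\<top>}. f \<sqinter> x \<noteq> \<bottom>"
    using assms meet_comm[of \<top> x] by simp
  ultimately obtain G where G: "G \<in> proper_filters" "x \<in> G"
    using filter_adjoin assms by blast
  \<comment> \<open>Zorn's lemma is applied to the filters containing \<open>x\<close>. Maximality
    there is maximality among all proper filters, as whatever lies above \<open>U\<close> contains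
    \<open>x\<close> too.\<close>
  have "\<exists>U\<in>{F \<in> proper_filters. x \<in> F}. \<forall>F\<in>{F \<in> proper_filters. x \<in> F}. U \<subseteq> F \<longrightarrow> F = U"
  proof (rule subset_Zorn_nonempty)
    show "{F \<in> proper_filters. x \<in> F} \<noteq> {}" using G by blast
    fix \<C> assume ne: "\<C> \<noteq> {}" and ch: "subset.chain {F \<in> proper_filters. x \<in> F} \<C>"
    have "\<C> \<subseteq> {F \<in> proper_filters. x \<in> F}"
      using ch by (simp add: subset_chain_def)
    then have filter: "F \<subseteq> carrier B" "\<top> \<in> F" "\<bottom> \<notin> F" "x \<in> F"
        "\<And>u v. u \<in> F \<Longrightarrow> v \<in> F \<Longrightarrow> u \<sqinter> v \<in> F" "\<And>u v. u \<in> F \<Longrightarrow> v \<in> carrier B \<Longrightarrow> u \<squnion> v \<in> F"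
      if "F \<in> \<C>" for F
      using that unfolding proper_filters_def by blast+
    have "u \<sqinter> v \<in> \<Union>\<C>" if uv: "u \<in> \<Union>\<C>" "v \<in> \<Union>\<C>" for u v
    proof -
      obtain F G where FG: "F \<in> \<C>" "G \<in> \<C>" "u \<in> F" "v \<in> G"
        using uv by blast
      then have "F \<subseteq> G \<or> G \<subseteq> F"
        using ch by (auto simp: subset_chain_def)
      then show ?thesis
        using FG filter(5) by blast
    qed
    moreover have "\<Union>\<C> \<subseteq> carrier B" "\<bottom> \<notin> \<Union>\<C>"
      using filter(1,3) by blast+
    moreover have "\<top> \<in> \<Union>\<C>" "x \<in> \<Union>\<C>"
      using ne filter(2,4) by blast+
    moreover have "u \<squnion> v \<in> \<Union>\<C>" if "u \<in> \<Union>\<C>" "v \<in> carrier B" for u v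
      using that filter(6) by blast
    ultimately show "\<Union>\<C> \<in> {F \<in> proper_filters. x \<in> F}"
      unfolding proper_filters_def by simp
  qed
  then show ?thesis
    using that by blast
qed

text \<open>If \<open>x \<notin> U\<close>, then by maximality \<open>x\<close> cannot be adjoined,
  so some \<open>f \<in> U\<close> is disjoint from \<open>x\<close> and hence lies below
  \<open>neg B x\<close>. This gives the clause for negation. The one for joins follows: with
  \<open>neg B x\<close> and \<open>neg B y\<close> in \<open>U\<close>, having
  \<open>x \<squnion> y\<close> in \<open>U\<close> as well would force \<bottom> into
  \<open>U\<close>.\<close>

lemma ultrafilter_hom:
  assumes U: "U \<in> proper_filters" and max: "\<And>F. F \<in> proper_filters \<Longrightarrow> U \<subseteq> F \<Longrightarrow> F = U"
  shows "(\<lambda>x\<in>carrier B. x \<in> U) \<in> balg_hom B two"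
proof -
  have UB: "U \<subseteq> carrier B" and one: "\<top> \<in> U" and zero: "\<bottom> \<notin> U"
    and UM: "\<And>f g. f \<in> U \<Longrightarrow> g \<in> U \<Longrightarrow> f \<sqinter> g \<in> U"
    and UJ: "\<And>f g. f \<in> U \<Longrightarrow> g \<in> carrier B \<Longrightarrow> f \<squnion> g \<in> U"
    using U by (auto simp: proper_filters_def)
  have neg: "neg B x \<in> U \<longleftrightarrow> x \<notin> U" if x: "x \<in> carrier B" for x
  proof
    show "x \<notin> U" if "neg B x \<in> U"
      using UM[of x "neg B x"] zero that x by auto
    assume "x \<notin> U"
    then obtain f where f: "f \<in> U" "f \<sqinter> x = \<bottom>"
      using filter_adjoin[OF U x] max by blast
    then have "f \<sqinter> neg B x = f"
      using meet_join[of f x "neg B x"] UB x join_comm[of \<bottom> "f \<sqinter> neg B x"] by auto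
    then show "neg B x \<in> U"
      using filter_upward[OF U f(1)] x by simp
  qed
  have meet: "x \<sqinter> y \<in> U \<longleftrightarrow> x \<in> U \<and> y \<in> U" if "x \<in> carrier B" "y \<in> carrier B" for x y
    using UM UJ[of "x \<sqinter> y"] that
    by (metis closed(4) join_absorb join_comm meet_comm)
  have join: "x \<squnion> y \<in> U \<longleftrightarrow> x \<in> U \<or> y \<in> U" if c: "x \<in> carrier B" "y \<in> carrier B" for x y
  proof
    assume xy: "x \<squnion> y \<in> U"
    show "x \<in> U \<or> y \<in> U"
    proof (rule ccontr)
      assume "\<not> (x \<in> U \<or> y \<in> U)"
      then have "neg B y \<in> U" "neg B x \<sqinter> (x \<squnion> y) \<in> U"
        using neg UM xy c by auto
      moreover have "neg B x \<sqinter> (x \<squnion> y) = neg B x \<sqinter> y"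
        using meet_join[of "neg B x" x y] meet_comm[of "neg B x" x]
          join_comm[of \<bottom> "neg B x \<sqinter> y"] c by simp
      ultimately have "neg B x \<sqinter> y \<sqinter> neg B y \<in> U"
        using UM by simp
      then show False
        using zero c by (simp add: meet_assoc)
    qed
  next
    show "x \<in> U \<or> y \<in> U \<Longrightarrow> x \<squnion> y \<in> U"
      using UJ join_comm[of x y] c by metis
  qed
  show ?thesis
    by (rule balg_homI) (use one zero neg meet join in \<open>simp_all add: two_def\<close>)
qed

text \<open>If \<open>x \<sqinter> neg B y\<close> and \<open>y \<sqinter> neg B x\<close> were both
  \<bottom>, then \<open>x = x \<sqinter> y = y\<close>. An ultrafilter through whichever difference
  is not \<bottom> contains exactly one of the two elements.\<close>

theorem separating_hom:
  assumes c: "x \<in> carrier B" "y \<in> carrier B" and "x \<noteq> y"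
  shows "\<exists>h\<in>balg_hom B two. h x \<noteq> h y"
proof -
  have sep: "\<exists>h\<in>balg_hom B two. h x \<noteq> h y"
    if c: "x \<in> carrier B" "y \<in> carrier B" and nz: "x \<sqinter> neg B y \<noteq> \<bottom>" for x y
  proof -
    obtain U where U: "U \<in> proper_filters" "x \<sqinter> neg B y \<in> U"
        "\<And>F. F \<in> proper_filters \<Longrightarrow> U \<subseteq> F \<Longrightarrow> F = U"
      using ultrafilter_exists[of "x \<sqinter> neg B y"] nz c by auto
    let ?h = "\<lambda>x\<in>carrier B. x \<in> U"
    have hom: "?h \<in> balg_hom B two"
      using ultrafilter_hom U by blast
    have "?h (x \<sqinter> neg B y)"
      using U c by simp
    then have "?h x \<noteq> ?h y"
      using balg_homD[OF hom] c by (simp add: two_def)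
    then show ?thesis using hom by blast
  qed
  have eq: "x = x \<sqinter> y" if c: "x \<in> carrier B" "y \<in> carrier B" and "x \<sqinter> neg B y = \<bottom>" for x y
    using meet_join[of x y "neg B y"] that by simp
  have "x \<sqinter> neg B y \<noteq> \<bottom> \<or> y \<sqinter> neg B x \<noteq> \<bottom>"
    using eq[of x y] eq[of y x] meet_comm[OF c] assms by metis
  then show ?thesis
    using sep[of x y] sep[of y x] c by metis
qed

end

section \<open>Free Boolean algebras\<close>

primrec teval :: "'b balg \<Rightarrow> ('x \<Rightarrow> 'b) \<Rightarrow> 'x bterm \<Rightarrow> 'b" where
  "teval B a (Var i) = a i"
| "teval B a Zero = bzero B"
| "teval B a One = bone B"
| "teval B a (Neg t) = neg B (teval B a t)"
| "teval B a (Meet s t) = meet B (teval B a s) (teval B a t)"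
| "teval B a (Join s t) = join B (teval B a s) (teval B a t)"

lemma op_closed_term_alg: "op_closed (term_alg \<mu>)"
  by (auto simp: op_closed_def term_alg_def)

lemma term_alg_simps [simp]:
  "t \<in> carrier (term_alg \<mu>) \<longleftrightarrow> vars t \<subseteq> {..<\<mu>}"
  "meet (term_alg \<mu>) = Meet" "join (term_alg \<mu>) = Join" "neg (term_alg \<mu>) = Neg"
  "bzero (term_alg \<mu>) = Zero" "bone (term_alg \<mu>) = One"
  by (simp_all add: term_alg_def)

text \<open>Congruences are stable under intersection. The explicit restriction to pairs from the
  carrier makes \<open>free_cong\<close> a relation on the carrier by definition.\<close>

lemma congruence_free_cong: "congruence (term_alg \<mu>) (free_cong \<mu>)"
proof -
  define K where "K = {\<theta>. congruence (term_alg \<mu>) \<theta> \<and> boolean_alg (quot (term_alg \<mu>) \<theta>)}"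
  have free: "(s, t) \<in> free_cong \<mu> \<longleftrightarrow>
      vars s \<subseteq> {..<\<mu>} \<and> vars t \<subseteq> {..<\<mu>} \<and> (\<forall>\<theta>\<in>K. (s, t) \<in> \<theta>)" for s t
    by (auto simp: free_cong_def K_def)
  have K: "congruence (term_alg \<mu>) \<theta>" if "\<theta> \<in> K" for \<theta>
    using that by (simp add: K_def)
  have "equiv (carrier (term_alg \<mu>)) (free_cong \<mu>)"
  proof (rule equivI)
    show "free_cong \<mu> \<subseteq> carrier (term_alg \<mu>) \<times> carrier (term_alg \<mu>)"
      by (auto simp: free)
    show "refl_on (carrier (term_alg \<mu>)) (free_cong \<mu>)"
      using congruence_refl[OF K] by (auto simp: refl_on_def free)
    show "sym (free_cong \<mu>)"
      using congruence_sym[OF K] by (auto simp: sym_def free)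
    show "trans (free_cong \<mu>)"
    proof (rule transI)
      fix s t u assume st: "(s, t) \<in> free_cong \<mu>" "(t, u) \<in> free_cong \<mu>"
      have "(s, u) \<in> \<theta>" if "\<theta> \<in> K" for \<theta>
        using congruence_trans[OF K[OF that], of s t u] st that by (simp add: free)
      then show "(s, u) \<in> free_cong \<mu>"
        using st by (simp add: free)
    qed
  qed
  moreover have "(Neg s, Neg s') \<in> free_cong \<mu>" if "(s, s') \<in> free_cong \<mu>" for s s'
    using congruence_neg[OF K] that by (simp add: free)
  moreover have "(Meet s t, Meet s' t') \<in> free_cong \<mu> \<and> (Join s t, Join s' t') \<in> free_cong \<mu>"
    if "(s, s') \<in> free_cong \<mu>" "(t, t') \<in> free_cong \<mu>" for s s' t t'
    using congruence_meet[OF K] congruence_join[OF K] that by (simp add: free)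
  ultimately show ?thesis
    by (auto simp: congruence_def)
qed

text \<open>Each instance of a law lies in every congruence with Boolean quotient, hence in their
  intersection; \<open>boolean_alg_quot_iff\<close> is used in both directions.\<close>

lemma boolean_alg_free_alg: "boolean_alg (free_alg \<mu>)"
proof -
  have "boolean_laws (term_alg \<mu>) (free_cong \<mu>)"
  proof -
    have "boolean_laws (term_alg \<mu>) \<theta>"
      if "congruence (term_alg \<mu>) \<theta>" "boolean_alg (quot (term_alg \<mu>) \<theta>)" for \<theta>
      using boolean_alg_quot_iff[OF that(1) op_closed_term_alg] that(2) by simp
    then show ?thesis
      by (simp add: boolean_laws_def free_cong_def)
  qed
  then show ?thesis
    using boolean_alg_quot_iff[OF congruence_free_cong[of \<mu>] op_closed_term_alg]
    by (simp add: free_alg_def)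
qed

lemmas op_closed_free_alg = boolean_alg_op_closed[OF boolean_alg_free_alg]

lemmas free_alg_class_ops =
  quot_neg[OF congruence_free_cong, folded free_alg_def]
  quot_meet[OF congruence_free_cong, folded free_alg_def]
  quot_join[OF congruence_free_cong, folded free_alg_def]
  quot_zero[OF congruence_free_cong, folded free_alg_def]
  quot_one[OF congruence_free_cong, folded free_alg_def]

lemma class_in_free_alg: "vars t \<subseteq> {..<\<mu>} \<Longrightarrow> free_cong \<mu> `` {t} \<in> carrier (free_alg \<mu>)"
  using class_in_quot[OF congruence_free_cong] by (simp add: free_alg_def)

lemma gen_in_free_alg: "\<beta> < \<mu> \<Longrightarrow> gen \<mu> \<beta> \<in> carrier (free_alg \<mu>)"
  by (simp add: gen_def class_in_free_alg)

lemma free_algE: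
  assumes "p \<in> carrier (free_alg \<mu>)"
  obtains t where "vars t \<subseteq> {..<\<mu>}" "p = free_cong \<mu> `` {t}"
  using assms by (auto simp: free_alg_def quot_def elim!: quotientE)

text \<open>Homomorphisms out of the free algebra are computed on representing terms from the images
  of the generators. This yields the uniqueness half of freeness,
  \<open>free_hom_eqI\<close>.\<close>

lemma hom_class_eq_teval:
  assumes h: "h \<in> balg_hom (free_alg \<mu>) B" and t: "vars t \<subseteq> {..<\<mu>}"
  shows "h (free_cong \<mu> `` {t}) = teval B (\<lambda>\<beta>. h (gen \<mu> \<beta>)) t"
  using t
proof (induction t)
  case (Neg t)
  then show ?case
    using balg_homD(4)[OF h class_in_free_alg] by (simp add: free_alg_class_ops)
next
  case (Meet s t)
  then show ?case
    using balg_homD(5)[OF h class_in_free_alg class_in_free_alg]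
    by (simp add: free_alg_class_ops)
next
  case (Join s t)
  then show ?case
    using balg_homD(6)[OF h class_in_free_alg class_in_free_alg]
    by (simp add: free_alg_class_ops)
next
  case Zero
  then show ?case
    using balg_homD(2)[OF h] by (simp add: free_alg_class_ops)
next
  case One
  then show ?case
    using balg_homD(3)[OF h] by (simp add: free_alg_class_ops)
qed (simp add: gen_def)

lemma teval_cong: "(\<And>i. i \<in> vars t \<Longrightarrow> a i = b i) \<Longrightarrow> teval B a t = teval B b t"
  by (induction t) auto

lemma free_hom_eqI:
  assumes h: "h \<in> balg_hom (free_alg \<mu>) B" and k: "k \<in> balg_hom (free_alg \<mu>) B"
    and eq: "\<And>\<beta>. \<beta> < \<mu> \<Longrightarrow> h (gen \<mu> \<beta>) = k (gen \<mu> \<beta>)"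
  shows "h = k"
proof (rule balg_hom_eqI[OF h k])
  fix p assume "p \<in> carrier (free_alg \<mu>)"
  then obtain t where t: "vars t \<subseteq> {..<\<mu>}" "p = free_cong \<mu> `` {t}"
    by (rule free_algE)
  show "h p = k p"
    using teval_cong[of t "\<lambda>\<beta>. h (gen \<mu> \<beta>)" "\<lambda>\<beta>. k (gen \<mu> \<beta>)" B] t eq
    by (auto simp: hom_class_eq_teval[OF h] hom_class_eq_teval[OF k])
qed

text \<open>The existence half of freeness. The kernel of term evaluation in \<open>B\<close>
  inherits the laws of \<open>B\<close>, so it is one of the congruences intersected in
  \<open>free_cong\<close>, and evaluation factors through the free algebra.\<close>

lemma free_hom_exists:
  assumes B: "boolean_alg B" and a: "\<And>\<beta>. \<beta> < \<mu> \<Longrightarrow> a \<beta> \<in> carrier B"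
  obtains h where "h \<in> balg_hom (free_alg \<mu>) B" "\<And>\<beta>. \<beta> < \<mu> \<Longrightarrow> h (gen \<mu> \<beta>) = a \<beta>"
proof -
  let ?T = "term_alg \<mu>"
  let ?e = "\<lambda>t\<in>carrier ?T. teval B a t"
  have "teval B a t \<in> carrier B" if "vars t \<subseteq> {..<\<mu>}" for t
    using that by (induction t) (use a in \<open>auto simp: op_closedD[OF boolean_alg_op_closed[OF B]]\<close>)
  then have e: "?e \<in> balg_hom ?T B"
    by (intro balg_homI) simp_all
  have "congruence ?T (ker ?T ?e)" "boolean_alg (quot ?T (ker ?T ?e))"
    using congruence_ker[OF op_closed_term_alg e] boolean_laws_ker[OF op_closed_term_alg e B]
      boolean_alg_quot_iff[OF _ op_closed_term_alg] by blast+
  then have le: "free_cong \<mu> \<subseteq> ker ?T ?e"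
    by (auto simp: free_cong_def)
  show ?thesis
  proof
    show "factor ?T (free_cong \<mu>) ?e \<in> balg_hom (free_alg \<mu>) B"
      using factor_hom[OF op_closed_term_alg congruence_free_cong e le]
      by (simp add: free_alg_def)
    show "factor ?T (free_cong \<mu>) ?e (gen \<mu> \<beta>) = a \<beta>" if "\<beta> < \<mu>" for \<beta>
      using factor_class[OF op_closed_term_alg congruence_free_cong e le, of "Var \<beta>"] that
      by (simp add: gen_def)
  qed
qed

section \<open>Evaluation and the Galois connection\<close>

lemma ev_hom:
  shows ev_hom_in: "ev_hom \<mu> a \<in> balg_hom (free_alg \<mu>) two"
    and ev_hom_gen: "\<beta> < \<mu> \<Longrightarrow> ev_hom \<mu> a (gen \<mu> \<beta>) = a \<beta>"
proof -
  obtain h where h: "h \<in> balg_hom (free_alg \<mu>) two" "\<And>\<beta>. \<beta> < \<mu> \<Longrightarrow> h (gen \<mu> \<beta>) = a \<beta>"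
    using free_hom_exists[OF boolean_alg_two, of \<mu> a] by (auto simp: two_def)
  have "ev_hom \<mu> a = h"
    unfolding ev_hom_def
  proof (rule the_equality)
    show "h \<in> balg_hom (free_alg \<mu>) two \<and> (\<forall>\<beta><\<mu>. h (gen \<mu> \<beta>) = a \<beta>)"
      using h by blast
    show "k = h" if "k \<in> balg_hom (free_alg \<mu>) two \<and> (\<forall>\<beta><\<mu>. k (gen \<mu> \<beta>) = a \<beta>)" for k
      using that h by (intro free_hom_eqI) auto
  qed
  then show "ev_hom \<mu> a \<in> balg_hom (free_alg \<mu>) two"
    and "\<beta> < \<mu> \<Longrightarrow> ev_hom \<mu> a (gen \<mu> \<beta>) = a \<beta>"
    using h by auto
qed

lemma ev_gen: "\<beta> < \<mu> \<Longrightarrow> ev \<mu> (gen \<mu> \<beta>) a = a \<beta>"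
  by (simp add: ev_def ev_hom_gen)

text \<open>Used to turn an abstract homomorphism to \<open>two\<close> into a point of the cube:
  its coordinates are the values on the generators.\<close>

lemma ev_eq_hom:
  assumes "h \<in> balg_hom (free_alg \<mu>) two" "p \<in> carrier (free_alg \<mu>)"
    "\<And>\<beta>. \<beta> < \<mu> \<Longrightarrow> h (gen \<mu> \<beta>) = a \<beta>"
  shows "ev \<mu> p a = h p"
  unfolding ev_def
  using free_hom_eqI[OF ev_hom_in assms(1)] assms(3) ev_hom_gen by metis

lemma ev_class:
  assumes "vars t \<subseteq> {..<\<mu>}" shows "ev \<mu> (free_cong \<mu> `` {t}) a = teval two a t"
proof -
  have "teval two (\<lambda>\<beta>. ev_hom \<mu> a (gen \<mu> \<beta>)) t = teval two a t"
    using assms by (intro teval_cong) (auto simp: ev_hom_gen)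
  then show ?thesis
    by (simp add: ev_def hom_class_eq_teval[OF ev_hom_in assms])
qed

text \<open>As functions of \<open>p\<close> both sides are homomorphisms to \<open>two\<close>, and
  by definition of \<open>dfun\<close> they agree on the generators.\<close>

lemma ev_hom_apply:
  assumes h: "h \<in> balg_hom (free_alg \<mu>) (free_alg \<nu>)" and p: "p \<in> carrier (free_alg \<mu>)"
    and a: "a \<in> cube \<nu>"
  shows "ev \<nu> (h p) a = ev \<mu> p (dfun \<mu> \<nu> h a)"
proof -
  have hom: "compose (carrier (free_alg \<mu>)) (ev_hom \<nu> a) h \<in> balg_hom (free_alg \<mu>) two"
    using balg_hom_compose[OF op_closed_free_alg h ev_hom_in] .
  have "ev \<mu> p (dfun \<mu> \<nu> h a) = compose (carrier (free_alg \<mu>)) (ev_hom \<nu> a) h p"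
    using a by (intro ev_eq_hom hom p) (simp add: dfun_def ev_def compose_eq gen_in_free_alg)
  then show ?thesis
    using p by (simp add: compose_eq ev_def)
qed

lemma dfun_in_cube: "a \<in> cube \<nu> \<Longrightarrow> dfun \<mu> \<nu> h a \<in> cube \<mu>"
  by (simp add: dfun_def cube_def two_def)

lemma cube_eqI: "a \<in> cube \<mu> \<Longrightarrow> b \<in> cube \<mu> \<Longrightarrow> (\<And>\<beta>. \<beta> < \<mu> \<Longrightarrow> a \<beta> = b \<beta>) \<Longrightarrow> a = b"
  unfolding cube_def by (rule PiE_ext) auto

lemma dfun_apply: "a \<in> cube \<nu> \<Longrightarrow> \<beta> < \<mu> \<Longrightarrow> dfun \<mu> \<nu> h a \<beta> = ev \<nu> (h (gen \<mu> \<beta>)) a"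
  by (simp add: dfun_def)

lemma dfun_compose:
  assumes h: "h \<in> balg_hom (free_alg \<mu>) (free_alg \<nu>)" and k: "k \<in> balg_hom (free_alg \<nu>) (free_alg \<kappa>)"
    and a: "a \<in> cube \<kappa>"
  shows "dfun \<mu> \<kappa> (compose (carrier (free_alg \<mu>)) k h) a = dfun \<mu> \<nu> h (dfun \<nu> \<kappa> k a)"
proof (rule cube_eqI)
  fix \<beta> assume "\<beta> < \<mu>"
  then show "dfun \<mu> \<kappa> (compose (carrier (free_alg \<mu>)) k h) a \<beta> = dfun \<mu> \<nu> h (dfun \<nu> \<kappa> k a) \<beta>"
    using a by (simp add: dfun_apply dfun_in_cube compose_eq gen_in_free_alg
        ev_hom_apply[OF k] balg_homD(1)[OF h])
qed (use a in \<open>auto intro: dfun_in_cube\<close>)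

lemma dfun_id:
  assumes a: "a \<in> cube \<mu>" shows "dfun \<mu> \<mu> (\<lambda>p\<in>carrier (free_alg \<mu>). p) a = a"
proof (rule cube_eqI)
  show "dfun \<mu> \<mu> (\<lambda>p\<in>carrier (free_alg \<mu>). p) a \<beta> = a \<beta>" if "\<beta> < \<mu>" for \<beta>
    using that by (simp add: dfun_apply[OF a] gen_in_free_alg ev_gen)
qed (simp_all add: a dfun_in_cube)

text \<open>An intersection of kernels of evaluation homomorphisms, one for each point of
  \<open>S\<close>; for empty \<open>S\<close> it is the full relation.\<close>

lemma congruence_CC: "congruence (free_alg \<mu>) (CC \<mu> S)"
proof -
  have "equiv (carrier (free_alg \<mu>)) (CC \<mu> S)"
    by (rule equivI) (auto simp: CC_def refl_on_def sym_def trans_def)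
  then show ?thesis
    using op_closedD[OF op_closed_free_alg[of \<mu>]] balg_homD[OF ev_hom_in[of \<mu>]]
    by (auto simp: congruence_def CC_def ev_def)
qed

lemma topspace_cantor_top [simp]: "topspace (cantor_top \<mu>) = cube \<mu>"
  by (simp add: cantor_top_def cube_def)

text \<open>The set and its complement are treated together, since \<open>Neg\<close> exchanges them
  in the induction.\<close>

lemma openin_cantor_ev:
  assumes "vars t \<subseteq> {..<\<mu>}"
  shows "openin (cantor_top \<mu>) {a \<in> cube \<mu>. teval two a t} \<and>
    openin (cantor_top \<mu>) {a \<in> cube \<mu>. \<not> teval two a t}"
proof -
  show ?thesis
    using assms
  proof (induction t)
    case (Var \<beta>)
    then have cont: "continuous_map (cantor_top \<mu>) (discrete_topology UNIV) (\<lambda>a. a \<beta>)"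
      using continuous_map_product_projection[of \<beta> "{..<\<mu>}" "\<lambda>_. discrete_topology UNIV"]
      by (simp add: cantor_top_def two_def)
    show ?case
      using openin_continuous_map_preimage[OF cont, of "{True}"]
        openin_continuous_map_preimage[OF cont, of "{False}"] by simp
  next
    case (Meet s t)
    have "{a \<in> cube \<mu>. teval two a (Meet s t)} =
        {a \<in> cube \<mu>. teval two a s} \<inter> {a \<in> cube \<mu>. teval two a t}"
      "{a \<in> cube \<mu>. \<not> teval two a (Meet s t)} =
        {a \<in> cube \<mu>. \<not> teval two a s} \<union> {a \<in> cube \<mu>. \<not> teval two a t}"
      by (auto simp: two_def)
    then show ?case
      using Meet by (auto intro: openin_Int openin_Un)
  next
    case (Join s t)
    have "{a \<in> cube \<mu>. teval two a (Join s t)} =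
        {a \<in> cube \<mu>. teval two a s} \<union> {a \<in> cube \<mu>. teval two a t}"
      "{a \<in> cube \<mu>. \<not> teval two a (Join s t)} =
        {a \<in> cube \<mu>. \<not> teval two a s} \<inter> {a \<in> cube \<mu>. \<not> teval two a t}"
      by (auto simp: two_def)
    then show ?case
      using Join by (auto intro: openin_Int openin_Un)
  qed (use openin_topspace[of "cantor_top \<mu>"] in \<open>simp_all add: two_def\<close>)
qed

text \<open>The complement is the union, over the pairs in \<open>R\<close>, of the sets where the
  two sides differ. Each of these is a symmetric difference of clopen sets given by terms.\<close>

lemma closedin_VV:
  assumes R: "R \<subseteq> carrier (free_alg \<mu>) \<times> carrier (free_alg \<mu>)"
  shows "closedin (cantor_top \<mu>) (VV \<mu> R)"
proof -
  have "openin (cantor_top \<mu>) {a \<in> cube \<mu>. ev \<mu> p a \<noteq> ev \<mu> q a}" if "(p, q) \<in> R" for p q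
  proof -
    have "p \<in> carrier (free_alg \<mu>)" "q \<in> carrier (free_alg \<mu>)"
      using R that by auto
    then obtain s t where st: "vars s \<subseteq> {..<\<mu>}" "p = free_cong \<mu> `` {s}"
        "vars t \<subseteq> {..<\<mu>}" "q = free_cong \<mu> `` {t}"
      by (metis free_algE)
    have "{a \<in> cube \<mu>. ev \<mu> p a \<noteq> ev \<mu> q a} =
        {a \<in> cube \<mu>. teval two a s} \<inter> {a \<in> cube \<mu>. \<not> teval two a t} \<union>
        {a \<in> cube \<mu>. \<not> teval two a s} \<inter> {a \<in> cube \<mu>. teval two a t}"
      using st by (auto simp: ev_class)
    then show ?thesis
      using openin_cantor_ev[OF st(1)] openin_cantor_ev[OF st(3)]
      by (auto intro: openin_Int openin_Un)
  qed
  then have "openin (cantor_top \<mu>) (\<Union>(p, q)\<in>R. {a \<in> cube \<mu>. ev \<mu> p a \<noteq> ev \<mu> q a})"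
    by (intro openin_Union) auto
  moreover have "(\<Union>(p, q)\<in>R. {a \<in> cube \<mu>. ev \<mu> p a \<noteq> ev \<mu> q a}) = cube \<mu> - VV \<mu> R"
    by (auto simp: VV_def)
  ultimately show ?thesis
    by (auto simp: closedin_def VV_def)
qed

text \<open>The conjunction of literals that prescribes the coordinates of \<open>a\<close> on
  \<open>J\<close>; such terms describe the basic neighbourhoods of \<open>a\<close>.\<close>

lemma literals_term:
  assumes "finite J" "J \<subseteq> I"
  obtains t where "vars t \<subseteq> I" "\<And>b. teval two b t \<longleftrightarrow> (\<forall>i\<in>J. b i = a i)"
proof -
  from assms have "\<exists>t. vars t \<subseteq> I \<and> (\<forall>b. teval two b t \<longleftrightarrow> (\<forall>i\<in>J. b i = a i))"
  proof (induction J)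
    case empty
    show ?case by (rule exI[of _ One]) (simp add: two_def)
  next
    case (insert j J)
    then obtain t where t: "vars t \<subseteq> I" "\<forall>b. teval two b t \<longleftrightarrow> (\<forall>i\<in>J. b i = a i)"
      by auto
    then show ?case
      using insert.prems
      by (intro exI[of _ "Meet (if a j then Var j else Neg (Var j)) t"]) (auto simp: two_def)
  qed
  then show ?thesis using that by blast
qed

text \<open>A point outside a closed \<open>S\<close> has a basic neighbourhood missing
  \<open>S\<close>. The term for that neighbourhood is false on all of \<open>S\<close> but true at
  the point, so the point violates an equation valid on \<open>S\<close>.\<close>

lemma VV_CC:
  assumes S: "closedin (cantor_top \<mu>) S"
  shows "VV \<mu> (CC \<mu> S) = S"
proof
  have "S \<subseteq> cube \<mu>"
    using closedin_subset[OF S] by simp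
  then show "S \<subseteq> VV \<mu> (CC \<mu> S)"
    by (auto simp: VV_def CC_def)
  show "VV \<mu> (CC \<mu> S) \<subseteq> S"
  proof (rule ccontr)
    assume "\<not> VV \<mu> (CC \<mu> S) \<subseteq> S"
    then obtain a where a: "a \<in> VV \<mu> (CC \<mu> S)" "a \<notin> S" by auto
    then have "a \<in> cube \<mu> - S" by (simp add: VV_def)
    moreover have "openin (cantor_top \<mu>) (cube \<mu> - S)"
      using S by (simp add: closedin_def)
    then have "\<forall>x\<in>cube \<mu> - S. \<exists>U. finite {i. i < \<mu> \<and> U i \<noteq> UNIV} \<and>
        x \<in> Pi\<^sub>E {..<\<mu>} U \<and> Pi\<^sub>E {..<\<mu>} U \<subseteq> cube \<mu> - S"
      by (simp add: cantor_top_def openin_product_topology_alt two_def)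
    ultimately obtain U where U: "finite {i. i < \<mu> \<and> U i \<noteq> UNIV}" "a \<in> Pi\<^sub>E {..<\<mu>} U"
        "Pi\<^sub>E {..<\<mu>} U \<subseteq> cube \<mu> - S"
      by (meson bspec)
    \<comment> \<open>\<open>t\<close> fixes the values of \<open>a\<close> on the finitely many
      coordinates that the box restricts; any \<open>b\<close> in the cube satisfying it lies in the
      box and so outside \<open>S\<close>.\<close>
    obtain t where t: "vars t \<subseteq> {..<\<mu>}"
        "\<And>b. teval two b t \<longleftrightarrow> (\<forall>i\<in>{i. i < \<mu> \<and> U i \<noteq> UNIV}. b i = a i)"
      using literals_term[OF U(1), of "{..<\<mu>}" a] by auto
    have "\<not> teval two b t" if "b \<in> S" for b
    proof
      assume b: "teval two b t"
      have "b i \<in> U i" if "i < \<mu>" for i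
        using b t(2) that U(2) by (cases "U i = UNIV") auto
      moreover have "b \<in> cube \<mu>"
        using \<open>b \<in> S\<close> \<open>S \<subseteq> cube \<mu>\<close> by blast
      ultimately have "b \<in> Pi\<^sub>E {..<\<mu>} U"
        by (auto simp: cube_def PiE_def)
      then show False
        using U(3) \<open>b \<in> S\<close> by blast
    qed
    then have "(free_cong \<mu> `` {t}, free_cong \<mu> `` {Zero}) \<in> CC \<mu> S"
      using t by (auto simp: CC_def class_in_free_alg ev_class two_def)
    then have "ev \<mu> (free_cong \<mu> `` {t}) a = ev \<mu> (free_cong \<mu> `` {Zero}) a"
      using a by (auto simp: VV_def)
    then show False
      using t by (simp add: ev_class) (simp add: two_def)
  qed
qed

text \<open>A pair outside \<theta> gives two distinct elements of a Boolean quotient, and a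
  homomorphism to \<open>two\<close> separating them is a point satisfying \<theta> at which the
  pair fails.\<close>

lemma CC_VV:
  assumes \<theta>: "congruence (free_alg \<mu>) \<theta>"
  shows "CC \<mu> (VV \<mu> \<theta>) = \<theta>"
proof
  show "\<theta> \<subseteq> CC \<mu> (VV \<mu> \<theta>)"
    using congruence_carrier[OF \<theta>] by (auto simp: CC_def VV_def)
  show "CC \<mu> (VV \<mu> \<theta>) \<subseteq> \<theta>"
  proof (rule ccontr)
    assume "\<not> CC \<mu> (VV \<mu> \<theta>) \<subseteq> \<theta>"
    then obtain p q where pq: "(p, q) \<in> CC \<mu> (VV \<mu> \<theta>)" "(p, q) \<notin> \<theta>" by auto
    then have c: "p \<in> carrier (free_alg \<mu>)" "q \<in> carrier (free_alg \<mu>)"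
      by (auto simp: CC_def)
    let ?Q = "quot (free_alg \<mu>) \<theta>"
    have "\<theta> `` {p} \<noteq> \<theta> `` {q}"
      using class_eq_iff[OF \<theta> c] pq(2) by simp
    then obtain h where h: "h \<in> balg_hom ?Q two" "h (\<theta> `` {p}) \<noteq> h (\<theta> `` {q})"
      using boolean_algebra_on.separating_hom[OF boolean_algebra_on.intro class_in_quot class_in_quot,
          OF boolean_alg_quot[OF \<theta> boolean_alg_free_alg] \<theta> c(1) \<theta> c(2)] by blast
    define k where "k = compose (carrier (free_alg \<mu>)) h (\<lambda>x\<in>carrier (free_alg \<mu>). \<theta> `` {x})"
    have k: "k \<in> balg_hom (free_alg \<mu>) two"
      unfolding k_def by (intro balg_hom_compose[OF op_closed_free_alg _ h(1)] balg_hom_class op_closed_free_alg \<theta>)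
    \<comment> \<open>The point representing \<open>k\<close>: evaluation at \<open>a\<close> is
      \<open>h\<close> on classes, so \<open>a\<close> satisfies every pair in \<theta> and still
      separates \<open>p\<close> from \<open>q\<close>.\<close>
    define a where "a = (\<lambda>\<beta>\<in>{..<\<mu>}. k (gen \<mu> \<beta>))"
    have ev: "ev \<mu> r a = h (\<theta> `` {r})" if "r \<in> carrier (free_alg \<mu>)" for r
      using ev_eq_hom[OF k that, of a] that by (simp add: a_def k_def compose_eq)
    have "ev \<mu> r a = ev \<mu> s a" if "(r, s) \<in> \<theta>" for r s
      using class_eqI[OF \<theta> that] congruence_carrier[OF \<theta> that] by (simp add: ev)
    moreover have "a \<in> cube \<mu>"
      by (simp add: a_def cube_def two_def)
    ultimately have "a \<in> VV \<mu> \<theta>"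
      by (auto simp: VV_def)
    then have "ev \<mu> p a = ev \<mu> q a"
      using pq(1) by (simp add: CC_def)
    then show False
      using ev c h(2) by simp
  qed
qed

section \<open>The affine adjunction\<close>

lemma compose_eq_restrictI: "(\<And>a. a \<in> A \<Longrightarrow> g (f a) = F a) \<Longrightarrow> compose A g f = restrict F A"
  unfolding compose_def by (rule restrict_ext)

text \<open>Shared by the categories of subsets, of presentations and of Boolean algebras.
  Extensionality of the maps makes the identity laws hold as equations of functions.\<close>

lemma concrete_category:
  assumes "\<And>X Y. X \<in> Obs \<Longrightarrow> Y \<in> Obs \<Longrightarrow> H X Y \<subseteq> U X \<rightarrow>\<^sub>E U Y"
    and "\<And>X. X \<in> Obs \<Longrightarrow> (\<lambda>x\<in>U X. x) \<in> H X X"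
    and "\<And>X Y Z f g. X \<in> Obs \<Longrightarrow> Y \<in> Obs \<Longrightarrow> Z \<in> Obs \<Longrightarrow> f \<in> H X Y \<Longrightarrow> g \<in> H Y Z \<Longrightarrow>
      compose (U X) g f \<in> H X Z"
  shows "category \<lparr>Ob = Obs, Hom = H, Idt = (\<lambda>X. \<lambda>x\<in>U X. x),
    Comp = (\<lambda>X Y Z g f. compose (U X) g f)\<rparr>"
proof -
  have fs: "f \<in> U X \<rightarrow> U Y" "f \<in> extensional (U X)"
    if "X \<in> Obs" "Y \<in> Obs" "f \<in> H X Y" for X Y f
    using subsetD[OF assms(1)[OF that(1,2)] that(3)] by (simp_all add: PiE_def)
  have id: "compose (U X) f (\<lambda>x\<in>U X. x) = f" "compose (U X) (\<lambda>x\<in>U Y. x) f = f"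
    if "X \<in> Obs" "Y \<in> Obs" "f \<in> H X Y" for X Y f
    using compose_Id[OF fs[OF that]] Id_compose[OF fs[OF that]] .
  have assoc: "compose (U W) h (compose (U W) g f) = compose (U W) (compose (U X) h g) f"
    if "W \<in> Obs" "X \<in> Obs" "f \<in> H W X" for W X f g h
    using compose_assoc[OF fs(1)[OF that]] .
  show ?thesis
    unfolding category_def precat.simps
    by (intro conjI ballI) (assumption | rule assms(2,3) id assoc)+
qed

lemma category_op_cat: "category C \<Longrightarrow> category (op_cat C)"
  unfolding category_def op_cat_def by simp

lemma category_full_subcat: "category C \<Longrightarrow> category (full_subcat C P)"
  unfolding category_def full_subcat_def by simp

lemma category_Vp_cat: "category Vp_cat"
  unfolding Vp_cat_def
proof (rule concrete_category)
  fix X :: "'a \<times> ('a bterm set \<times> 'a bterm set) set"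
  assume "X \<in> {(\<mu>, \<theta>). is_cardinal \<mu> \<and> congruence (free_alg \<mu>) \<theta>}"
  then have cl: "op_closed (pres_alg X)"
    using boolean_alg_op_closed[OF boolean_alg_quot[OF _ boolean_alg_free_alg]]
    by (auto simp: pres_alg_def)
  show "(\<lambda>x\<in>carrier (pres_alg X). x) \<in> balg_hom (pres_alg X) (pres_alg X)"
    using cl by (rule balg_hom_id)
  show "compose (carrier (pres_alg X)) g f \<in> balg_hom (pres_alg X) (pres_alg Z)"
    if "f \<in> balg_hom (pres_alg X) (pres_alg Y)" "g \<in> balg_hom (pres_alg Y) (pres_alg Z)" for Y Z f g
    using cl that by (rule balg_hom_compose)
qed (auto simp: balg_hom_def)

lemma definable_maps_iff:
  "f \<in> definable_maps X Y \<longleftrightarrow> (\<exists>h\<in>balg_hom (free_alg (fst Y)) (free_alg (fst X)).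
     dfun (fst Y) (fst X) h ` snd X \<subseteq> snd Y \<and> f = restrict (dfun (fst Y) (fst X) h) (snd X))"
  by (cases X; cases Y) (fastforce simp: definable_maps_def)

lemma category_D_cat: "category D_cat"
  unfolding D_cat_def
proof (rule concrete_category)
  fix X Y Z :: "'a \<times> ('a \<Rightarrow> bool) set" and f g
  assume X: "X \<in> {(\<mu>, S). is_cardinal \<mu> \<and> S \<subseteq> cube \<mu>}"
  then have XC: "snd X \<subseteq> cube (fst X)" by auto
  have "restrict (\<lambda>a. a) (snd X) = restrict (dfun (fst X) (fst X) (\<lambda>p\<in>carrier (free_alg (fst X)). p)) (snd X)"
    using XC by (intro restrict_ext) (simp add: dfun_id subset_iff)
  then show "(\<lambda>a\<in>snd X. a) \<in> definable_maps X X"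
    using XC unfolding definable_maps_iff
    by (intro bexI[OF _ balg_hom_id[OF op_closed_free_alg]]) (auto simp: dfun_id subset_iff)
  assume "f \<in> definable_maps X Y"
  then obtain h where h: "h \<in> balg_hom (free_alg (fst Y)) (free_alg (fst X))"
      "dfun (fst Y) (fst X) h ` snd X \<subseteq> snd Y" "f = restrict (dfun (fst Y) (fst X) h) (snd X)"
    by (auto simp: definable_maps_iff)
  assume "g \<in> definable_maps Y Z"
  then obtain k where k: "k \<in> balg_hom (free_alg (fst Z)) (free_alg (fst Y))"
      "dfun (fst Z) (fst Y) k ` snd Y \<subseteq> snd Z" "g = restrict (dfun (fst Z) (fst Y) k) (snd Y)"
    by (auto simp: definable_maps_iff)
  \<comment> \<open>The order reverses: \<open>g\<close> after \<open>f\<close> is induced by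
    \<open>h\<close> after \<open>k\<close> on free algebras.\<close>
  let ?l = "compose (carrier (free_alg (fst Z))) h k"
  have l: "dfun (fst Z) (fst X) ?l a = dfun (fst Z) (fst Y) k (dfun (fst Y) (fst X) h a)"
    if "a \<in> snd X" for a
    using that XC dfun_compose[OF k(1) h(1)] by blast
  have "compose (snd X) g f = restrict (dfun (fst Z) (fst X) ?l) (snd X)"
    using h(2) l by (intro compose_eq_restrictI) (simp add: h(3) k(3) image_subset_iff)
  moreover have "dfun (fst Z) (fst X) ?l ` snd X \<subseteq> snd Z"
    using h(2) k(2) l by (auto simp: image_subset_iff)
  ultimately show "compose (snd X) g f \<in> definable_maps X Z"
    using balg_hom_compose[OF op_closed_free_alg k(1) h(1)] unfolding definable_maps_iff by blast
qed (auto simp: definable_maps_def)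

section \<open>Homomorphisms of presented algebras and the maps of free algebras that induce
  them\<close>

definition compatible :: "('a \<times> 'a) set \<Rightarrow> ('b \<times> 'b) set \<Rightarrow> ('a \<Rightarrow> 'b) \<Rightarrow> bool" where
  "compatible \<theta> \<theta>' h \<longleftrightarrow> (\<forall>(p, q)\<in>\<theta>. (h p, h q) \<in> \<theta>')"

text \<open>A functional form of \<open>induced_by\<close>, so that arrows can be computed by
  rewriting; it has the intended meaning for \<open>compatible\<close> maps
  \<open>h\<close>.\<close>

definition induced :: "'i::wellorder \<times> ('i bterm set \<times> 'i bterm set) set \<Rightarrow>
    'i \<times> ('i bterm set \<times> 'i bterm set) set \<Rightarrow> ('i bterm set \<Rightarrow> 'i bterm set) \<Rightarrow>
    'i bterm set set \<Rightarrow> 'i bterm set set" where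
  "induced X Y h = factor (free_alg (fst X)) (snd X)
     (\<lambda>p\<in>carrier (free_alg (fst X)). snd Y `` {h p})"

context
  fixes X Y :: "'i::wellorder \<times> ('i bterm set \<times> 'i bterm set) set"
  assumes X: "congruence (free_alg (fst X)) (snd X)" and Y: "congruence (free_alg (fst Y)) (snd Y)"
begin

context
  fixes h :: "'i bterm set \<Rightarrow> 'i bterm set"
  assumes h: "h \<in> balg_hom (free_alg (fst X)) (free_alg (fst Y))"
begin

lemma class_hom: "(\<lambda>p\<in>carrier (free_alg (fst X)). snd Y `` {h p}) \<in> balg_hom (free_alg (fst X)) (pres_alg Y)"
proof -
  have "compose (carrier (free_alg (fst X))) (\<lambda>p\<in>carrier (free_alg (fst Y)). snd Y `` {p}) h
      \<in> balg_hom (free_alg (fst X)) (quot (free_alg (fst Y)) (snd Y))"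
    by (rule balg_hom_compose[OF op_closed_free_alg h balg_hom_class[OF op_closed_free_alg Y]])
  moreover have "compose (carrier (free_alg (fst X))) (\<lambda>p\<in>carrier (free_alg (fst Y)). snd Y `` {p}) h
      = (\<lambda>p\<in>carrier (free_alg (fst X)). snd Y `` {h p})"
    unfolding compose_def by (intro restrict_ext) (simp add: balg_homD(1)[OF h])
  ultimately show ?thesis
    by (simp add: pres_alg_def case_prod_beta)
qed

lemma
  assumes "compatible (snd X) (snd Y) h"
  shows induced_hom: "induced X Y h \<in> balg_hom (pres_alg X) (pres_alg Y)"
    and induced_class: "p \<in> carrier (free_alg (fst X)) \<Longrightarrow> induced X Y h (snd X `` {p}) = snd Y `` {h p}"
proof -
  have le: "snd X \<subseteq> ker (free_alg (fst X)) (\<lambda>p\<in>carrier (free_alg (fst X)). snd Y `` {h p})"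
    using assms congruence_carrier[OF X] class_eqI[OF Y] by (fastforce simp: ker_def compatible_def)
  show "induced X Y h \<in> balg_hom (pres_alg X) (pres_alg Y)"
    using factor_hom[OF op_closed_free_alg X class_hom le]
    by (simp add: induced_def pres_alg_def case_prod_beta)
  show "induced X Y h (snd X `` {p}) = snd Y `` {h p}" if "p \<in> carrier (free_alg (fst X))"
    using factor_class[OF op_closed_free_alg X class_hom le that] that by (simp add: induced_def)
qed

text \<open>Congruent elements have one class, hence one image under \<open>g\<close>, which forces
  compatibility; and \<open>g\<close> is determined because classes exhaust the quotient.\<close>

lemma induced_by_iff: "induced_by X Y h g \<longleftrightarrow> compatible (snd X) (snd Y) h \<and> g = induced X Y h"
proof
  assume g: "induced_by X Y h g"
  have "(h p, h q) \<in> snd Y" if "(p, q) \<in> snd X" for p q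
  proof -
    have c: "p \<in> carrier (free_alg (fst X))" "q \<in> carrier (free_alg (fst X))"
      using congruence_carrier[OF X that] by auto
    then have "snd Y `` {h p} = snd Y `` {h q}"
      using g class_eqI[OF X that] by (metis induced_by_def)
    then show ?thesis
      using class_eq_iff[OF Y] balg_homD(1)[OF h] c by blast
  qed
  then have "compatible (snd X) (snd Y) h"
    by (auto simp: compatible_def)
  moreover from this have "g = induced X Y h"
    using g balg_hom_quot_eqI[OF X, of g "pres_alg Y" "induced X Y h"] induced_hom
    by (simp add: induced_by_def induced_class pres_alg_def case_prod_beta)
  ultimately show "compatible (snd X) (snd Y) h \<and> g = induced X Y h" ..
next
  show "compatible (snd X) (snd Y) h \<and> g = induced X Y h \<Longrightarrow> induced_by X Y h g"
    using h induced_hom induced_class by (auto simp: induced_by_def)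
qed

end

text \<open>Free algebras are projective along quotient maps: choose a representative of the image
  of each generator and extend freely. Both ways around agree on generators, hence
  everywhere.\<close>

lemma pres_homE:
  assumes g: "g \<in> balg_hom (pres_alg X) (pres_alg Y)"
  obtains h where "h \<in> balg_hom (free_alg (fst X)) (free_alg (fst Y))"
    "compatible (snd X) (snd Y) h" "g = induced X Y h"
proof -
  let ?F = "free_alg (fst X)"
  let ?c = "\<lambda>p\<in>carrier ?F. snd X `` {p}"
  have PX: "pres_alg X = quot ?F (snd X)" and PY: "pres_alg Y = quot (free_alg (fst Y)) (snd Y)"
    by (simp_all add: pres_alg_def case_prod_beta)
  have gc: "compose (carrier ?F) g ?c \<in> balg_hom ?F (pres_alg Y)"
    using balg_hom_compose[OF op_closed_free_alg balg_hom_class[OF op_closed_free_alg X]] g PX by simp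
  have "\<exists>q. q \<in> carrier (free_alg (fst Y)) \<and> g (snd X `` {gen (fst X) \<beta>}) = snd Y `` {q}"
    if "\<beta> < fst X" for \<beta>
  proof -
    have "g (snd X `` {gen (fst X) \<beta>}) \<in> carrier (pres_alg Y)"
      using balg_homD(1)[OF g] class_in_quot[OF X] gen_in_free_alg[OF that] PX by simp
    then show ?thesis
      unfolding PY by (auto simp: quot_def elim!: quotientE)
  qed
  then obtain q where q: "\<And>\<beta>. \<beta> < fst X \<Longrightarrow> q \<beta> \<in> carrier (free_alg (fst Y))"
      "\<And>\<beta>. \<beta> < fst X \<Longrightarrow> g (snd X `` {gen (fst X) \<beta>}) = snd Y `` {q \<beta>}"
    by metis
  obtain h where h: "h \<in> balg_hom ?F (free_alg (fst Y))" "\<And>\<beta>. \<beta> < fst X \<Longrightarrow> h (gen (fst X) \<beta>) = q \<beta>"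
    by (rule free_hom_exists[OF boolean_alg_free_alg, where \<mu> = "fst X" and a = q]) (use q(1) in auto)
  have eq: "compose (carrier ?F) g ?c = (\<lambda>p\<in>carrier ?F. snd Y `` {h p})"
    using gc class_hom[OF h(1)]
    by (rule free_hom_eqI) (simp add: compose_eq gen_in_free_alg h(2) q(2))
  have "g (snd X `` {p}) = snd Y `` {h p}" if "p \<in> carrier ?F" for p
    using fun_cong[OF eq, of p] that by (simp add: compose_eq)
  then have "induced_by X Y h g"
    using h(1) g by (simp add: induced_by_def)
  then show ?thesis
    using that h(1) induced_by_iff[OF h(1)] by blast
qed

end

lemma compatible_compose:
  assumes "congruence (free_alg \<mu>) \<theta>" "compatible \<theta> \<theta>' h" "compatible \<theta>' \<theta>'' k"
  shows "compatible \<theta> \<theta>'' (compose (carrier (free_alg \<mu>)) k h)"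
  using assms(2,3) congruence_carrier[OF assms(1)] by (fastforce simp: compatible_def compose_eq)

lemma induced_compose:
  assumes X: "congruence (free_alg (fst X)) (snd X)" and Y: "congruence (free_alg (fst Y)) (snd Y)"
    and Z: "congruence (free_alg (fst Z)) (snd Z)"
    and h: "h \<in> balg_hom (free_alg (fst X)) (free_alg (fst Y))" "compatible (snd X) (snd Y) h"
    and k: "k \<in> balg_hom (free_alg (fst Y)) (free_alg (fst Z))" "compatible (snd Y) (snd Z) k"
  shows "induced X Z (compose (carrier (free_alg (fst X))) k h) =
    compose (carrier (pres_alg X)) (induced Y Z k) (induced X Y h)"
proof -
  let ?l = "compose (carrier (free_alg (fst X))) k h"
  have l: "?l \<in> balg_hom (free_alg (fst X)) (free_alg (fst Z))" "compatible (snd X) (snd Z) ?l"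
    using balg_hom_compose[OF op_closed_free_alg h(1) k(1)] compatible_compose[OF X h(2) k(2)] .
  have PX: "pres_alg X = quot (free_alg (fst X)) (snd X)"
    by (simp add: pres_alg_def case_prod_beta)
  have cl: "op_closed (pres_alg X)"
    using boolean_alg_op_closed[OF boolean_alg_quot[OF X boolean_alg_free_alg]] by (simp add: PX)
  have "induced X Z ?l \<in> balg_hom (pres_alg X) (pres_alg Z)"
    using induced_hom[OF X Z l] .
  moreover have "compose (carrier (pres_alg X)) (induced Y Z k) (induced X Y h) \<in> balg_hom (pres_alg X) (pres_alg Z)"
    using balg_hom_compose[OF cl induced_hom[OF X Y h] induced_hom[OF Y Z k]] .
  ultimately show ?thesis
    unfolding PX
    by (rule balg_hom_quot_eqI[OF X])
      (simp add: induced_class[OF X Z l] compose_eq class_in_quot[OF X] induced_class[OF X Y h]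
        induced_class[OF Y Z k] balg_homD(1)[OF h(1)])
qed

lemma induced_eqI:
  assumes X: "congruence (free_alg (fst X)) (snd X)" and Y: "congruence (free_alg (fst Y)) (snd Y)"
    and h: "h \<in> balg_hom (free_alg (fst X)) (free_alg (fst Y))" "compatible (snd X) (snd Y) h"
    and k: "k \<in> balg_hom (free_alg (fst X)) (free_alg (fst Y))" "compatible (snd X) (snd Y) k"
    and hk: "\<And>p. p \<in> carrier (free_alg (fst X)) \<Longrightarrow> (h p, k p) \<in> snd Y"
  shows "induced X Y h = induced X Y k"
proof (rule balg_hom_quot_eqI[OF X])
  show "induced X Y h \<in> balg_hom (quot (free_alg (fst X)) (snd X)) (pres_alg Y)"
    "induced X Y k \<in> balg_hom (quot (free_alg (fst X)) (snd X)) (pres_alg Y)"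
    using induced_hom[OF X Y h] induced_hom[OF X Y k] by (simp_all add: pres_alg_def case_prod_beta)
qed (simp add: induced_class[OF X Y h] induced_class[OF X Y k] class_eqI[OF Y hk])

lemma induced_id:
  assumes X: "congruence (free_alg (fst X)) (snd X)"
  shows "induced X X (\<lambda>p\<in>carrier (free_alg (fst X)). p) = (\<lambda>P\<in>carrier (pres_alg X). P)"
proof (rule balg_hom_quot_eqI[OF X])
  have PX: "pres_alg X = quot (free_alg (fst X)) (snd X)"
    by (simp add: pres_alg_def case_prod_beta)
  have comp: "compatible (snd X) (snd X) (\<lambda>p\<in>carrier (free_alg (fst X)). p)"
    using congruence_carrier[OF X] by (auto simp: compatible_def)
  note id = balg_hom_id[OF op_closed_free_alg] comp
  show "induced X X (\<lambda>p\<in>carrier (free_alg (fst X)). p) \<in> balg_hom (quot (free_alg (fst X)) (snd X)) (pres_alg X)"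
    using induced_hom[OF X X id] by (simp add: PX)
  show "(\<lambda>P\<in>carrier (pres_alg X). P) \<in> balg_hom (quot (free_alg (fst X)) (snd X)) (pres_alg X)"
    unfolding PX
    by (rule balg_hom_id[OF boolean_alg_op_closed[OF boolean_alg_quot[OF X boolean_alg_free_alg]]])
  show "induced X X (\<lambda>p\<in>carrier (free_alg (fst X)). p) (snd X `` {p}) =
      (\<lambda>P\<in>carrier (pres_alg X). P) (snd X `` {p})" if "p \<in> carrier (free_alg (fst X))" for p
    using that by (simp add: induced_class[OF X X id] PX class_in_quot[OF X])
qed

text \<open>By \<open>ev_hom_apply\<close>, the value of \<open>h p\<close> at a point of
  \<open>T\<close> is the value of \<open>p\<close> at its image, a point of \<open>S\<close>; so
  equations valid on \<open>S\<close> go to equations valid on \<open>T\<close>.\<close>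

lemma compatible_CC:
  assumes h: "h \<in> balg_hom (free_alg \<mu>) (free_alg \<nu>)" and "T \<subseteq> cube \<nu>" "dfun \<mu> \<nu> h ` T \<subseteq> S"
  shows "compatible (CC \<mu> S) (CC \<nu> T) h"
proof -
  have "ev \<nu> (h p) a = ev \<nu> (h q) a" if "(p, q) \<in> CC \<mu> S" "a \<in> T" for p q a
    using that assms(2,3) by (auto simp: CC_def ev_hom_apply[OF h] subset_iff)
  then show ?thesis
    using balg_homD(1)[OF h] by (auto simp: compatible_def CC_def)
qed

text \<open>The same identity read the other way: the image of \<open>a\<close> satisfies
  \<open>(p, q)\<close> as soon as \<open>a\<close> satisfies \<open>(h p, h q)\<close>, which lies
  in \<open>\<theta>'\<close> by compatibility.\<close>

lemma dfun_VV:
  assumes h: "h \<in> balg_hom (free_alg \<mu>) (free_alg \<nu>)" and \<theta>: "congruence (free_alg \<mu>) \<theta>"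
    and comp: "compatible \<theta> \<theta>' h"
  shows "dfun \<mu> \<nu> h ` VV \<nu> \<theta>' \<subseteq> VV \<mu> \<theta>"
proof (rule image_subsetI)
  fix a assume a: "a \<in> VV \<nu> \<theta>'"
  then have ac: "a \<in> cube \<nu>" by (simp add: VV_def)
  have "ev \<mu> p (dfun \<mu> \<nu> h a) = ev \<mu> q (dfun \<mu> \<nu> h a)" if pq: "(p, q) \<in> \<theta>" for p q
  proof -
    have "(h p, h q) \<in> \<theta>'"
      using comp pq by (auto simp: compatible_def)
    then have "ev \<nu> (h p) a = ev \<nu> (h q) a"
      using a by (auto simp: VV_def)
    then show ?thesis
      using ev_hom_apply[OF h _ ac] congruence_carrier[OF \<theta> pq] by simp
  qed
  then show "dfun \<mu> \<nu> h a \<in> VV \<mu> \<theta>"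
    using dfun_in_cube[OF ac] by (auto simp: VV_def)
qed

text \<open>Evaluates the description in \<open>C_functor\<close>. If \<open>h\<close> and
  \<open>k\<close> define the same map on \<open>snd X\<close>, then \<open>h p\<close> and
  \<open>k p\<close> agree at all its points, so they are congruent modulo \<open>CC\<close> and
  induce the same homomorphism.\<close>

lemma C_functor_arr:
  assumes SX: "snd X \<subseteq> cube (fst X)"
    and h: "h \<in> balg_hom (free_alg (fst Y)) (free_alg (fst X))" "dfun (fst Y) (fst X) h ` snd X \<subseteq> snd Y"
  shows "FArr C_functor X Y (restrict (dfun (fst Y) (fst X) h) (snd X)) = induced (C_ob Y) (C_ob X) h"
proof -
  have C: "fst (C_ob X) = fst X" "snd (C_ob X) = CC (fst X) (snd X)"
    "fst (C_ob Y) = fst Y" "snd (C_ob Y) = CC (fst Y) (snd Y)"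
    by (simp_all add: C_ob_def case_prod_beta)
  have cX: "congruence (free_alg (fst (C_ob X))) (snd (C_ob X))"
    and cY: "congruence (free_alg (fst (C_ob Y))) (snd (C_ob Y))"
    by (simp_all add: C congruence_CC)
  have comp: "compatible (CC (fst Y) (snd Y)) (CC (fst X) (snd X)) h"
    by (rule compatible_CC[OF h(1) SX h(2)])
  have uniq: "induced (C_ob Y) (C_ob X) k = induced (C_ob Y) (C_ob X) h"
    if k: "k \<in> balg_hom (free_alg (fst Y)) (free_alg (fst X))"
      and eq: "restrict (dfun (fst Y) (fst X) h) (snd X) = restrict (dfun (fst Y) (fst X) k) (snd X)"
      and comp': "compatible (CC (fst Y) (snd Y)) (CC (fst X) (snd X)) k" for k
  proof (rule induced_eqI[OF cY cX])
    fix p assume p: "p \<in> carrier (free_alg (fst (C_ob Y)))"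
    have "ev (fst X) (k p) a = ev (fst X) (h p) a" if "a \<in> snd X" for a
      using fun_cong[OF eq, of a] that SX p
      by (auto simp: ev_hom_apply[OF k] ev_hom_apply[OF h(1)] C subset_iff)
    then show "(k p, h p) \<in> snd (C_ob X)"
      using p balg_homD(1)[OF k] balg_homD(1)[OF h(1)] by (simp add: C CC_def)
  qed (simp_all add: C k comp' h comp)
  have ind: "induced_by (C_ob Y) (C_ob X) k g \<longleftrightarrow>
      compatible (CC (fst Y) (snd Y)) (CC (fst X) (snd X)) k \<and> g = induced (C_ob Y) (C_ob X) k"
    if "k \<in> balg_hom (free_alg (fst Y)) (free_alg (fst X))" for k g
    using induced_by_iff[OF cY cX, of k g] that by (simp add: C)
  have "(\<exists>k\<in>balg_hom (free_alg (fst Y)) (free_alg (fst X)).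
      restrict (dfun (fst Y) (fst X) h) (snd X) = restrict (dfun (fst Y) (fst X) k) (snd X) \<and>
      induced_by (C_ob Y) (C_ob X) k g) \<longleftrightarrow> g = induced (C_ob Y) (C_ob X) h" (is "?L \<longleftrightarrow> ?R") for g
  proof
    assume ?L
    then obtain k where k: "k \<in> balg_hom (free_alg (fst Y)) (free_alg (fst X))"
        "restrict (dfun (fst Y) (fst X) h) (snd X) = restrict (dfun (fst Y) (fst X) k) (snd X)"
        "induced_by (C_ob Y) (C_ob X) k g" by auto
    then show ?R
      using ind[OF k(1)] uniq[OF k(1,2)] by simp
  next
    assume ?R
    then show ?L
      using h(1) comp ind[OF h(1)] by (intro bexI[of _ h]) simp_all
  qed
  then show ?thesis
    by (simp add: C_functor_def)
qed

text \<open>Evaluates the description in \<open>V_functor\<close>. If \<open>h\<close> and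
  \<open>k\<close> induce the same homomorphism, they send each generator to congruent elements, and
  these values are the coordinates of the two maps on \<open>VV\<close>.\<close>

lemma V_functor_arr:
  assumes X: "congruence (free_alg (fst X)) (snd X)" and Y: "congruence (free_alg (fst Y)) (snd Y)"
    and h: "h \<in> balg_hom (free_alg (fst X)) (free_alg (fst Y))" "compatible (snd X) (snd Y) h"
  shows "FArr V_functor Y X (induced X Y h) = restrict (dfun (fst X) (fst Y) h) (VV (fst Y) (snd Y))"
proof -
  have V: "snd (V_ob Y) = VV (fst Y) (snd Y)"
    by (simp add: V_ob_def case_prod_beta)
  have uniq: "restrict (dfun (fst X) (fst Y) k) (VV (fst Y) (snd Y)) =
      restrict (dfun (fst X) (fst Y) h) (VV (fst Y) (snd Y))"
    if k: "k \<in> balg_hom (free_alg (fst X)) (free_alg (fst Y))" "compatible (snd X) (snd Y) k"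
      and eq: "induced X Y h = induced X Y k" for k
  proof (rule restrict_ext)
    fix a assume a: "a \<in> VV (fst Y) (snd Y)"
    then have ac: "a \<in> cube (fst Y)" by (simp add: VV_def)
    show "dfun (fst X) (fst Y) k a = dfun (fst X) (fst Y) h a"
    proof (rule cube_eqI)
      fix \<beta> assume \<beta>: "\<beta> < fst X"
      have g: "gen (fst X) \<beta> \<in> carrier (free_alg (fst X))"
        using gen_in_free_alg[OF \<beta>] .
      have "snd Y `` {k (gen (fst X) \<beta>)} = snd Y `` {h (gen (fst X) \<beta>)}"
        using fun_cong[OF eq, of "snd X `` {gen (fst X) \<beta>}"] g
        by (simp add: induced_class[OF X Y h] induced_class[OF X Y k])
      then have "(k (gen (fst X) \<beta>), h (gen (fst X) \<beta>)) \<in> snd Y"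
        using class_eq_iff[OF Y] g balg_homD(1)[OF k(1)] balg_homD(1)[OF h(1)] by blast
      then show "dfun (fst X) (fst Y) k a \<beta> = dfun (fst X) (fst Y) h a \<beta>"
        using a ac \<beta> by (auto simp: dfun_apply VV_def)
    qed (simp_all add: dfun_in_cube ac)
  qed
  have "(\<exists>k\<in>balg_hom (free_alg (fst X)) (free_alg (fst Y)). induced_by X Y k (induced X Y h) \<and>
      f = restrict (dfun (fst X) (fst Y) k) (VV (fst Y) (snd Y))) \<longleftrightarrow>
      f = restrict (dfun (fst X) (fst Y) h) (VV (fst Y) (snd Y))" (is "?L \<longleftrightarrow> ?R") for f
  proof
    assume ?L
    then obtain k where k: "k \<in> balg_hom (free_alg (fst X)) (free_alg (fst Y))"
        "induced_by X Y k (induced X Y h)" "f = restrict (dfun (fst X) (fst Y) k) (VV (fst Y) (snd Y))"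
      by auto
    then show ?R
      using induced_by_iff[OF X Y k(1)] uniq[OF k(1)] by simp
  next
    assume ?R
    then show ?L
      using h induced_by_iff[OF X Y h(1)] by (intro bexI[of _ h]) simp_all
  qed
  then show ?thesis
    by (simp add: V_functor_def V)
qed

section \<open>Functoriality and the equivalence with closed subsets\<close>

lemma Vp_cat_simps:
  "X \<in> Ob (op_cat Vp_cat) \<longleftrightarrow> is_cardinal (fst X) \<and> congruence (free_alg (fst X)) (snd X)"
  "Hom (op_cat Vp_cat) X Y = balg_hom (pres_alg Y) (pres_alg X)"
  "Idt (op_cat Vp_cat) X = (\<lambda>P\<in>carrier (pres_alg X). P)"
  "Comp (op_cat Vp_cat) X Y Z g f = compose (carrier (pres_alg Z)) f g"
  by (auto simp: op_cat_def Vp_cat_def)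

lemma closed_cat_simps:
  "X \<in> Ob closed_cat \<longleftrightarrow> is_cardinal (fst X) \<and> snd X \<subseteq> cube (fst X) \<and> closedin (cantor_top (fst X)) (snd X)"
  "Hom closed_cat = definable_maps"
  "Idt closed_cat X = (\<lambda>a\<in>snd X. a)"
  "Comp closed_cat X Y Z g f = compose (snd X) g f"
  by (auto simp: closed_cat_def full_subcat_def D_cat_def)

lemma functor_ob_simps:
  "FOb C_functor X = C_ob X" "FOb V_functor Z = V_ob Z"
  "fst (C_ob X) = fst X" "snd (C_ob X) = CC (fst X) (snd X)"
  "fst (V_ob Z) = fst Z" "snd (V_ob Z) = VV (fst Z) (snd Z)"
  by (simp_all add: C_functor_def V_functor_def C_ob_def V_ob_def case_prod_beta)

lemma is_functor_C: "is_functor closed_cat (op_cat Vp_cat) C_functor"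
  unfolding is_functor_def
proof (intro conjI ballI)
  note simps = Vp_cat_simps closed_cat_simps functor_ob_simps
  have C: "congruence (free_alg (fst (C_ob X))) (snd (C_ob X))" for X :: "'a \<times> ('a \<Rightarrow> bool) set"
    by (simp add: simps congruence_CC)
  fix X :: "'a \<times> ('a \<Rightarrow> bool) set" assume X: "X \<in> Ob closed_cat"
  then have SX: "snd X \<subseteq> cube (fst X)" by (simp add: simps)
  show "FOb C_functor X \<in> Ob (op_cat Vp_cat)"
    using X by (simp add: simps congruence_CC)
  have id: "dfun (fst X) (fst X) (\<lambda>p\<in>carrier (free_alg (fst X)). p) a = a" if "a \<in> snd X" for a
    using that SX dfun_id by blast
  have "FArr C_functor X X (restrict (dfun (fst X) (fst X) (\<lambda>p\<in>carrier (free_alg (fst X)). p)) (snd X))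
      = induced (C_ob X) (C_ob X) (\<lambda>p\<in>carrier (free_alg (fst X)). p)"
    using SX id by (intro C_functor_arr balg_hom_id op_closed_free_alg) auto
  moreover have "restrict (dfun (fst X) (fst X) (\<lambda>p\<in>carrier (free_alg (fst X)). p)) (snd X) = (\<lambda>a\<in>snd X. a)"
    using id by (intro restrict_ext)
  ultimately show "FArr C_functor X X (Idt closed_cat X) = Idt (op_cat Vp_cat) (FOb C_functor X)"
    using induced_id[OF C, of X] by (simp add: simps)
  fix Y :: "'a \<times> ('a \<Rightarrow> bool) set" and f
  assume Y: "Y \<in> Ob closed_cat" and f: "f \<in> Hom closed_cat X Y"
  then have SY: "snd Y \<subseteq> cube (fst Y)" by (simp add: simps)
  from f obtain h where h: "h \<in> balg_hom (free_alg (fst Y)) (free_alg (fst X))"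
      "dfun (fst Y) (fst X) h ` snd X \<subseteq> snd Y" "f = restrict (dfun (fst Y) (fst X) h) (snd X)"
    by (auto simp: simps definable_maps_iff)
  have fh: "FArr C_functor X Y f = induced (C_ob Y) (C_ob X) h"
    using C_functor_arr[OF SX h(1,2)] h(3) by simp
  have h': "h \<in> balg_hom (free_alg (fst (C_ob Y))) (free_alg (fst (C_ob X)))"
      "compatible (snd (C_ob Y)) (snd (C_ob X)) h"
    using h compatible_CC[OF h(1) SX h(2)] by (simp_all add: simps)
  show "FArr C_functor X Y f \<in> Hom (op_cat Vp_cat) (FOb C_functor X) (FOb C_functor Y)"
    unfolding fh using induced_hom[OF C C h'] by (simp add: simps)
  fix Z :: "'a \<times> ('a \<Rightarrow> bool) set" and g
  assume g: "g \<in> Hom closed_cat Y Z"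
  then obtain k where k: "k \<in> balg_hom (free_alg (fst Z)) (free_alg (fst Y))"
      "dfun (fst Z) (fst Y) k ` snd Y \<subseteq> snd Z" "g = restrict (dfun (fst Z) (fst Y) k) (snd Y)"
    by (auto simp: simps definable_maps_iff)
  have gk: "FArr C_functor Y Z g = induced (C_ob Z) (C_ob Y) k"
    using C_functor_arr[OF SY k(1,2)] k(3) by simp
  have k': "k \<in> balg_hom (free_alg (fst (C_ob Z))) (free_alg (fst (C_ob Y)))"
      "compatible (snd (C_ob Z)) (snd (C_ob Y)) k"
    using k compatible_CC[OF k(1) SY k(2)] by (simp_all add: simps)
  let ?l = "compose (carrier (free_alg (fst Z))) h k"
  have l: "dfun (fst Z) (fst X) ?l a = dfun (fst Z) (fst Y) k (dfun (fst Y) (fst X) h a)"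
    if "a \<in> snd X" for a
    using that SX dfun_compose[OF k(1) h(1)] by blast
  have gf: "compose (snd X) g f = restrict (dfun (fst Z) (fst X) ?l) (snd X)"
    using h(2) l by (intro compose_eq_restrictI) (simp add: h(3) k(3) image_subset_iff)
  have "FArr C_functor X Z (compose (snd X) g f) = induced (C_ob Z) (C_ob X) ?l"
    unfolding gf
    using balg_hom_compose[OF op_closed_free_alg k(1) h(1)] h(2) k(2) l SX
    by (intro C_functor_arr) (auto simp: image_subset_iff)
  then show "FArr C_functor X Z (Comp closed_cat X Y Z g f) =
      Comp (op_cat Vp_cat) (FOb C_functor X) (FOb C_functor Y) (FOb C_functor Z)
        (FArr C_functor Y Z g) (FArr C_functor X Y f)"
    using induced_compose[OF C C C k' h'] by (simp add: simps fh gk)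
qed

lemma is_functor_V: "is_functor (op_cat Vp_cat) closed_cat V_functor"
  unfolding is_functor_def
proof (intro conjI ballI)
  note simps = Vp_cat_simps closed_cat_simps functor_ob_simps
  fix X :: "'a \<times> ('a bterm set \<times> 'a bterm set) set" assume "X \<in> Ob (op_cat Vp_cat)"
  then have card: "is_cardinal (fst X)" and X: "congruence (free_alg (fst X)) (snd X)"
    by (simp_all add: simps)
  have VX: "VV (fst X) (snd X) \<subseteq> cube (fst X)"
    by (auto simp: VV_def)
  have "snd X \<subseteq> carrier (free_alg (fst X)) \<times> carrier (free_alg (fst X))"
    using congruence_carrier[OF X] by auto
  then show "FOb V_functor X \<in> Ob closed_cat"
    using card VX closedin_VV by (simp add: simps)
  have id: "compatible (snd X) (snd X) (\<lambda>p\<in>carrier (free_alg (fst X)). p)"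
    using congruence_carrier[OF X] by (auto simp: compatible_def)
  have "restrict (dfun (fst X) (fst X) (\<lambda>p\<in>carrier (free_alg (fst X)). p)) (VV (fst X) (snd X)) =
      (\<lambda>a\<in>VV (fst X) (snd X). a)"
    using VX dfun_id by (intro restrict_ext) blast
  then show "FArr V_functor X X (Idt (op_cat Vp_cat) X) = Idt closed_cat (FOb V_functor X)"
    using V_functor_arr[OF X X balg_hom_id[OF op_closed_free_alg] id] induced_id[OF X]
    by (simp add: simps)
  fix Y :: "'a \<times> ('a bterm set \<times> 'a bterm set) set" and f
  assume "Y \<in> Ob (op_cat Vp_cat)" and f: "f \<in> Hom (op_cat Vp_cat) X Y"
  then have Y: "congruence (free_alg (fst Y)) (snd Y)"
    by (simp add: simps)
  obtain h where h: "h \<in> balg_hom (free_alg (fst Y)) (free_alg (fst X))"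
      "compatible (snd Y) (snd X) h" "f = induced Y X h"
    using pres_homE[OF Y X] f by (auto simp: simps)
  show "FArr V_functor X Y f \<in> Hom closed_cat (FOb V_functor X) (FOb V_functor Y)"
    using h(1) dfun_VV[OF h(1) Y h(2)]
    by (auto simp: h(3) V_functor_arr[OF Y X h(1,2)] simps definable_maps_iff)
  fix Z :: "'a \<times> ('a bterm set \<times> 'a bterm set) set" and g
  assume "Z \<in> Ob (op_cat Vp_cat)" and g: "g \<in> Hom (op_cat Vp_cat) Y Z"
  then have Z: "congruence (free_alg (fst Z)) (snd Z)"
    by (simp add: simps)
  obtain k where k: "k \<in> balg_hom (free_alg (fst Z)) (free_alg (fst Y))"
      "compatible (snd Z) (snd Y) k" "g = induced Z Y k"
    using pres_homE[OF Z Y] g by (auto simp: simps)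
  let ?l = "compose (carrier (free_alg (fst Z))) h k"
  have l: "?l \<in> balg_hom (free_alg (fst Z)) (free_alg (fst X))" "compatible (snd Z) (snd X) ?l"
    using balg_hom_compose[OF op_closed_free_alg k(1) h(1)] compatible_compose[OF Z k(2) h(2)] .
  have "compose (VV (fst X) (snd X)) (restrict (dfun (fst Z) (fst Y) k) (VV (fst Y) (snd Y)))
        (restrict (dfun (fst Y) (fst X) h) (VV (fst X) (snd X))) =
      restrict (dfun (fst Z) (fst X) ?l) (VV (fst X) (snd X))"
    using dfun_VV[OF h(1) Y h(2)] VX dfun_compose[OF k(1) h(1)]
    by (intro compose_eq_restrictI) (simp add: image_subset_iff subset_iff)
  then show "FArr V_functor X Z (Comp (op_cat Vp_cat) X Y Z g f) =
      Comp closed_cat (FOb V_functor X) (FOb V_functor Y) (FOb V_functor Z)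
        (FArr V_functor Y Z g) (FArr V_functor X Y f)"
    by (simp add: simps h(3) k(3) V_functor_arr[OF Y X h(1,2)] V_functor_arr[OF Z Y k(1,2)]
        induced_compose[OF Z Y X k(1,2) h(1,2), symmetric] V_functor_arr[OF Z X l])
qed

text \<open>The composite functors are known to be the identity only on actual objects and arrows,
  which does not make them equal to \<open>id_functor\<close> as records; the identity arrows still
  form a natural isomorphism.\<close>

lemma natural_iso_identity:
  assumes "category C" "\<And>X. X \<in> Ob C \<Longrightarrow> FOb F X = X"
    "\<And>X Y f. X \<in> Ob C \<Longrightarrow> Y \<in> Ob C \<Longrightarrow> f \<in> Hom C X Y \<Longrightarrow> FArr F X Y f = f"
  shows "natural_iso C C id_functor F (Idt C)" "natural_iso C C F id_functor (Idt C)"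
  using assms unfolding natural_iso_def iso_arrow_def category_def id_functor_def by auto

theorem closed_cat_equivalence: "equivalence closed_cat (op_cat Vp_cat) C_functor V_functor"
proof -
  note simps = Vp_cat_simps closed_cat_simps functor_ob_simps
  let ?VC = "comp_functor V_functor C_functor" and ?CV = "comp_functor C_functor V_functor"
  have cat: "category (closed_cat :: ('a \<times> ('a \<Rightarrow> bool) set, _) precat)"
    "category (op_cat Vp_cat :: ('a \<times> ('a bterm set \<times> 'a bterm set) set, _) precat)"
    by (simp_all add: closed_cat_def category_full_subcat category_D_cat category_op_cat category_Vp_cat)
  have VC: "V_ob (C_ob X) = X" if "X \<in> Ob closed_cat" for X :: "'a \<times> ('a \<Rightarrow> bool) set"
    using that by (simp add: simps prod_eq_iff VV_CC)
  have CV: "C_ob (V_ob X) = X" if "X \<in> Ob (op_cat Vp_cat)" for X :: "'a \<times> ('a bterm set \<times> 'a bterm set) set"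
    using that by (simp add: simps prod_eq_iff CC_VV)
  have C: "congruence (free_alg (fst (C_ob X))) (snd (C_ob X))" for X :: "'a \<times> ('a \<Rightarrow> bool) set"
    by (simp add: simps congruence_CC)
  have VC_arr: "FArr ?VC X Y f = f"
    if X: "X \<in> Ob closed_cat" and Y: "Y \<in> Ob closed_cat" and f: "f \<in> Hom closed_cat X Y"
    for X Y :: "'a \<times> ('a \<Rightarrow> bool) set" and f
  proof -
    have SX: "snd X \<subseteq> cube (fst X)" "VV (fst X) (CC (fst X) (snd X)) = snd X"
      using X VV_CC by (auto simp: simps)
    from f obtain h where h: "h \<in> balg_hom (free_alg (fst Y)) (free_alg (fst X))"
        "dfun (fst Y) (fst X) h ` snd X \<subseteq> snd Y" "f = restrict (dfun (fst Y) (fst X) h) (snd X)"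
      by (auto simp: simps definable_maps_iff)
    have "FArr V_functor (C_ob X) (C_ob Y) (induced (C_ob Y) (C_ob X) h) = f"
      using V_functor_arr[OF C C, of h Y X] h compatible_CC[OF h(1) SX(1) h(2)]
      by (simp add: simps SX)
    then show ?thesis
      using C_functor_arr[OF SX(1) h(1,2)] h(3) by (simp add: comp_functor_def simps)
  qed
  have CV_arr: "FArr ?CV X Y f = f"
    if "X \<in> Ob (op_cat Vp_cat)" "Y \<in> Ob (op_cat Vp_cat)" "f \<in> Hom (op_cat Vp_cat) X Y"
    for X Y :: "'a \<times> ('a bterm set \<times> 'a bterm set) set" and f
  proof -
    have X: "congruence (free_alg (fst X)) (snd X)" and Y: "congruence (free_alg (fst Y)) (snd Y)"
      using that by (simp_all add: simps)
    have "f \<in> balg_hom (pres_alg Y) (pres_alg X)"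
      using that(3) by (simp add: simps)
    then obtain h where h: "h \<in> balg_hom (free_alg (fst Y)) (free_alg (fst X))"
        "compatible (snd Y) (snd X) h" "f = induced Y X h"
      by (rule pres_homE[OF Y X])
    have "FArr C_functor (V_ob X) (V_ob Y) (restrict (dfun (fst Y) (fst X) h) (VV (fst X) (snd X))) =
        induced (C_ob (V_ob Y)) (C_ob (V_ob X)) h"
      using C_functor_arr[of "V_ob X" h "V_ob Y"] h(1) dfun_VV[OF h(1) Y h(2)]
      by (simp add: simps) (auto simp: VV_def)
    then show ?thesis
      \<comment> \<open>\<open>simps(9,10)\<close> are the two equations for \<open>FOb\<close>;
        membership in \<open>Ob (op_cat Vp_cat)\<close> stays folded to match the condition of
        \<open>CV\<close>.\<close>
      using V_functor_arr[OF Y X h(1,2)] CV that h(3) by (simp add: comp_functor_def simps(9,10))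
  qed
  have "natural_iso closed_cat closed_cat id_functor ?VC (Idt (closed_cat :: ('a \<times> ('a \<Rightarrow> bool) set, _) precat))"
    using VC VC_arr by (intro natural_iso_identity cat) (simp_all add: comp_functor_def functor_ob_simps)
  moreover have "natural_iso (op_cat Vp_cat) (op_cat Vp_cat) ?CV id_functor
      (Idt (op_cat Vp_cat :: ('a \<times> ('a bterm set \<times> 'a bterm set) set, _) precat))"
    using CV CV_arr by (intro natural_iso_identity cat) (simp_all add: comp_functor_def functor_ob_simps)
  ultimately show ?thesis
    unfolding equivalence_def using cat is_functor_C is_functor_V by blast
qed

section \<open>Presented algebras and all Boolean algebras\<close>

text \<open>The usual criterion for an equivalence, in the special case that hom-sets, identities
  and composition of \<open>C\<close> are literally those of \<open>D\<close> along
  \<open>F\<close>, so that the functor leaves arrows unchanged. The inverse comes from choosing,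
  for each object of \<open>D\<close>, an isomorphic image and an isomorphism.\<close>

lemma equivalence_if_essentially_surjective:
  fixes C :: "('o, 'm) precat" and D :: "('p, 'm) precat"
  assumes C: "category C" and D: "category D"
    and ob: "\<And>X. X \<in> Ob C \<Longrightarrow> F X \<in> Ob D"
    and hom: "\<And>X Y. X \<in> Ob C \<Longrightarrow> Y \<in> Ob C \<Longrightarrow> Hom C X Y = Hom D (F X) (F Y)"
    and idt: "\<And>X. X \<in> Ob C \<Longrightarrow> Idt C X = Idt D (F X)"
    and comp: "\<And>X Y Z. X \<in> Ob C \<Longrightarrow> Y \<in> Ob C \<Longrightarrow> Z \<in> Ob C \<Longrightarrow> Comp C X Y Z = Comp D (F X) (F Y) (F Z)"
    and surj: "\<And>B. B \<in> Ob D \<Longrightarrow> \<exists>X\<in>Ob C. \<exists>e. iso_arrow D (F X) B e"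
  shows "\<exists>F G. equivalence C D F G"
proof -
  from surj have "\<forall>B\<in>Ob D. \<exists>X e i. X \<in> Ob C \<and> e \<in> Hom D (F X) B \<and> i \<in> Hom D B (F X) \<and>
      Comp D (F X) B (F X) i e = Idt D (F X) \<and> Comp D B (F X) B e i = Idt D B"
    unfolding iso_arrow_def by blast
  then obtain g e i where g: "\<And>B. B \<in> Ob D \<Longrightarrow> g B \<in> Ob C"
    and e: "\<And>B. B \<in> Ob D \<Longrightarrow> e B \<in> Hom D (F (g B)) B"
    and i: "\<And>B. B \<in> Ob D \<Longrightarrow> i B \<in> Hom D B (F (g B))"
    and ie: "\<And>B. B \<in> Ob D \<Longrightarrow> Comp D (F (g B)) B (F (g B)) (i B) (e B) = Idt D (F (g B))"
    and ei: "\<And>B. B \<in> Ob D \<Longrightarrow> Comp D B (F (g B)) B (e B) (i B) = Idt D B"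
    by metis
  let ?c = "Comp D"
  have cl: "?c X Y Z k f \<in> Hom D X Z"
    if "X \<in> Ob D" "Y \<in> Ob D" "Z \<in> Ob D" "f \<in> Hom D X Y" "k \<in> Hom D Y Z" for X Y Z f k
    using D that unfolding category_def by blast
  have idr: "?c X X Y f (Idt D X) = f" and idl: "?c X Y Y (Idt D Y) f = f"
    if "X \<in> Ob D" "Y \<in> Ob D" "f \<in> Hom D X Y" for X Y f
    using D that unfolding category_def by blast+
  have assoc: "?c W X Z (?c X Y Z h k) f = ?c W Y Z h (?c W X Y k f)"
    if "W \<in> Ob D" "X \<in> Ob D" "Y \<in> Ob D" "Z \<in> Ob D"
      "f \<in> Hom D W X" "k \<in> Hom D X Y" "h \<in> Hom D Y Z" for W X Y Z f k h
    using D that unfolding category_def by metis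
  have Fg: "F (g B) \<in> Ob D" if "B \<in> Ob D" for B
    using ob g that by blast
  define FF where "FF = \<lparr>FOb = F, FArr = (\<lambda>X Y (f::'m). f)\<rparr>"
  \<comment> \<open>On arrows \<open>G\<close> conjugates with the chosen isomorphisms; the result
    is an arrow of \<open>C\<close> because \<open>hom\<close> identifies the hom-sets.\<close>
  define G where "G = \<lparr>FOb = g, FArr = (\<lambda>B B' f.
    ?c (F (g B)) B' (F (g B')) (i B') (?c (F (g B)) B B' f (e B)))\<rparr>"
  note simps = FF_def G_def comp_functor_def id_functor_def
  \<comment> \<open>Two cancellations of an adjacent isomorphism and its inverse: \<open>eif\<close>
    gives functoriality of \<open>G\<close> and naturality of \<open>e\<close>, \<open>fei\<close>
    naturality of the unit.\<close>
  have eif: "?c X (F (g B)) B (e B) (?c X B (F (g B)) (i B) f) = f"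
    if "X \<in> Ob D" "B \<in> Ob D" "f \<in> Hom D X B" for X B f
    using that by (simp add: assoc[symmetric] Fg e i ei idl)
  have fei: "?c B (F (g B)) Y (?c (F (g B)) B Y f (e B)) (i B) = f"
    if "Y \<in> Ob D" "B \<in> Ob D" "f \<in> Hom D B Y" for Y B f
    using that by (simp add: assoc Fg e i ei idr)
  have functor_F: "is_functor C D FF"
    unfolding is_functor_def by (simp add: simps ob hom idt comp)
  have functor_G: "is_functor D C G"
    unfolding is_functor_def
  proof (intro conjI ballI)
    fix B assume B: "B \<in> Ob D"
    show "FOb G B \<in> Ob C" using g B by (simp add: simps)
    show "FArr G B B (Idt D B) = Idt C (FOb G B)"
      using B by (simp add: simps idt g idl e ie Fg)
    fix B' f assume B': "B' \<in> Ob D" and f: "f \<in> Hom D B B'"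
    show "FArr G B B' f \<in> Hom C (FOb G B) (FOb G B')"
      using B B' f by (simp add: simps hom g cl e i Fg)
    fix B'' k assume B'': "B'' \<in> Ob D" and k: "k \<in> Hom D B' B''"
    have "?c (F (g B)) B'' (F (g B'')) (i B'') (?c (F (g B)) B B'' (?c B B' B'' k f) (e B)) =
        ?c (F (g B)) B'' (F (g B'')) (i B'') (?c (F (g B)) (F (g B')) B'' (?c (F (g B')) B' B'' k (e B'))
          (?c (F (g B)) B' (F (g B')) (i B') (?c (F (g B)) B B' f (e B))))"
      using B B' B'' f k by (simp add: assoc Fg e i cl eif)
    then show "FArr G B B'' (Comp D B B' B'' k f) =
        Comp C (FOb G B) (FOb G B') (FOb G B'') (FArr G B' B'' k) (FArr G B B' f)"
      using B B' B'' f k by (simp add: simps comp g assoc Fg e i cl)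
  qed
  \<comment> \<open>\<open>i (F X)\<close> runs from \<open>F X\<close> to
    \<open>F (g (F X))\<close>, hence is also an arrow of \<open>C\<close> from \<open>X\<close> to
    \<open>g (F X)\<close>.\<close>
  have "natural_iso C C id_functor (comp_functor G FF) (\<lambda>X. i (F X))"
    unfolding natural_iso_def
  proof (intro conjI ballI)
    fix X assume X: "X \<in> Ob C"
    have "e (F X) \<in> Hom C (g (F X)) X"
      using X by (simp add: hom ob g e)
    then show "iso_arrow C (FOb id_functor X) (FOb (comp_functor G FF) X) (i (F X))"
      using X by (auto simp: iso_arrow_def simps hom ob g i comp idt ie ei intro!: bexI[of _ "e (F X)"])
    fix Y f assume "Y \<in> Ob C" "f \<in> Hom C X Y"
    then show "Comp C (FOb id_functor X) (FOb id_functor Y) (FOb (comp_functor G FF) Y)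
        (i (F Y)) (FArr id_functor X Y f) =
      Comp C (FOb id_functor X) (FOb (comp_functor G FF) X) (FOb (comp_functor G FF) Y)
        (FArr (comp_functor G FF) X Y f) (i (F X))"
      using X by (simp add: simps comp hom ob g assoc[of "F X" "F (g (F X))"] i e cl fei)
  qed
  moreover have "natural_iso D D (comp_functor FF G) id_functor e"
    unfolding natural_iso_def
  proof (intro conjI ballI)
    fix B assume B: "B \<in> Ob D"
    then show "iso_arrow D (FOb (comp_functor FF G) B) (FOb id_functor B) (e B)"
      using e i ie ei by (auto simp: iso_arrow_def simps intro!: bexI[of _ "i B"])
    fix B' f assume "B' \<in> Ob D" "f \<in> Hom D B B'"
    then show "Comp D (FOb (comp_functor FF G) B) (FOb (comp_functor FF G) B') (FOb id_functor B')
        (e B') (FArr (comp_functor FF G) B B' f) =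
      Comp D (FOb (comp_functor FF G) B) (FOb id_functor B) (FOb id_functor B')
        (FArr id_functor B B' f) (e B)"
      using B by (simp add: simps eif Fg cl e)
  qed
  ultimately show ?thesis
    using C D functor_F functor_G unfolding equivalence_def by blast
qed

lemma category_BA_cat: "category BA_cat"
  unfolding BA_cat_def
  by (rule concrete_category)
    (simp_all add: balg_hom_id balg_hom_compose boolean_alg_op_closed, auto simp: balg_hom_def)

lemma bij_hom_inverse:
  assumes cl: "op_closed A" and h: "h \<in> balg_hom A B" and bij: "bij_betw h (carrier A) (carrier B)"
  obtains k where "k \<in> balg_hom B A" "compose (carrier A) k h = (\<lambda>x\<in>carrier A. x)"
    "compose (carrier B) h k = (\<lambda>y\<in>carrier B. y)"
proof
  let ?k = "\<lambda>y\<in>carrier B. inv_into (carrier A) h y"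
  have inj: "inj_on h (carrier A)" and im: "h ` carrier A = carrier B"
    using bij by (auto simp: bij_betw_def)
  have kh: "?k (h x) = x" if "x \<in> carrier A" for x
    using that inj im by auto
  note ops = op_closedD[OF cl] and homs = balg_homD[OF h]
  \<comment> \<open>Surjectivity lets every element of \<open>B\<close> be written as
    \<open>h x\<close>, where \<open>kh\<close> computes the inverse.\<close>
  have all: "(\<forall>y\<in>carrier B. \<Phi> y) \<longleftrightarrow> (\<forall>x\<in>carrier A. \<Phi> (h x))" for \<Phi>
    unfolding im[symmetric] by blast
  have "?k (bzero B) = bzero A" "?k (bone B) = bone A"
    using kh[OF ops(1)] kh[OF ops(2)] by (simp_all add: homs(2,3))
  moreover have "\<forall>y\<in>carrier B. ?k y \<in> carrier A \<and> ?k (neg B y) = neg A (?k y)"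
    unfolding all using kh ops(3) homs(4) by metis
  moreover have "\<forall>y\<in>carrier B. \<forall>z\<in>carrier B.
      ?k (meet B y z) = meet A (?k y) (?k z) \<and> ?k (join B y z) = join A (?k y) (?k z)"
    unfolding all using kh ops(4,5) homs(5,6) by metis
  ultimately show "?k \<in> balg_hom B A"
    by (intro balg_homI) simp_all
  show "compose (carrier A) ?k h = (\<lambda>x\<in>carrier A. x)"
    using kh by (intro compose_eq_restrictI)
  show "compose (carrier B) h ?k = (\<lambda>y\<in>carrier B. y)"
    using im by (intro compose_eq_restrictI) (simp add: f_inv_into_f)
qed

section \<open>Sizes of free and presented algebras\<close>

primrec code_term :: "('x \<times> 'x \<Rightarrow> 'x) \<Rightarrow> (nat \<Rightarrow> 'x) \<Rightarrow> 'x bterm \<Rightarrow> 'x" where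
  "code_term p n (Var x) = p (n 0, x)"
| "code_term p n Zero = p (n 1, n 0)"
| "code_term p n One = p (n 2, n 0)"
| "code_term p n (Neg t) = p (n 3, code_term p n t)"
| "code_term p n (Meet s t) = p (n 4, p (code_term p n s, code_term p n t))"
| "code_term p n (Join s t) = p (n 5, p (code_term p n s, code_term p n t))"

lemma terms_lepoll:
  assumes "infinite A"
  shows "{t. vars t \<subseteq> A} \<lesssim> A"
proof -
  obtain p where p: "inj_on p (A \<times> A)" "p ` (A \<times> A) \<subseteq> A"
    using card_of_Times_same_infinite[OF assms] unfolding card_of_ordIso[symmetric] bij_betw_def by blast
  obtain n :: "nat \<Rightarrow> _" where n: "inj n" "range n \<subseteq> A"
    using assms by (auto simp: infinite_le_lepoll lepoll_def)
  have pA: "p (x, y) \<in> A" if "x \<in> A" "y \<in> A" for x y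
    using p(2) that by blast
  have nA: "n k \<in> A" for k
    using n(2) by blast
  have pp: "p (x, y) = p (x', y') \<longleftrightarrow> x = x' \<and> y = y'" if "x \<in> A" "y \<in> A" "x' \<in> A" "y' \<in> A" for x y x' y'
    using inj_onD[OF p(1), of "(x, y)" "(x', y')"] that by auto
  have cA: "code_term p n t \<in> A" if "vars t \<subseteq> A" for t
    using that by (induction t) (auto intro!: pA nA)
  note [simp] = pp pA nA cA inj_eq[OF n(1)]
  have "s = t" if "vars s \<subseteq> A" "vars t \<subseteq> A" "code_term p n s = code_term p n t" for s t
    using that
  proof (induction s arbitrary: t)
    case (Var x) then show ?case by (cases t) auto
  next
    case Zero then show ?case by (cases t) auto
  next
    case One then show ?case by (cases t) auto
  next
    case (Neg s) then show ?case by (cases t) auto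
  next
    case (Meet s1 s2) then show ?case by (cases t) auto
  next
    case (Join s1 s2) then show ?case by (cases t) auto
  qed
  then have "inj_on (code_term p n) {t. vars t \<subseteq> A}"
    by (auto intro: inj_onI)
  moreover have "code_term p n ` {t. vars t \<subseteq> A} \<subseteq> A"
    by auto
  ultimately show ?thesis
    unfolding lepoll_def by blast
qed

lemma quotient_lepoll: "A // r \<lesssim> A"
proof -
  have "A // r = (\<lambda>x. r `` {x}) ` A"
    by (auto simp: quotient_def)
  then show ?thesis by (simp add: image_lepoll)
qed

text \<open>Counting terms gives no finite bound. By separation an element is determined by its
  truth table, the set of points where it evaluates to true, and a finite cube has finitely many
  subsets.\<close>

lemma finite_free_alg:
  assumes "finite {..<\<mu>}" shows "finite (carrier (free_alg \<mu>))"
proof (rule finite_imageD)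
  have "finite (cube \<mu>)"
    unfolding cube_def using assms by (intro finite_PiE) auto
  then show "finite ((\<lambda>p. {a \<in> cube \<mu>. ev \<mu> p a}) ` carrier (free_alg \<mu>))"
    by (rule finite_subset[rotated, OF finite_Pow_iff[THEN iffD2]]) auto
  show "inj_on (\<lambda>p. {a \<in> cube \<mu>. ev \<mu> p a}) (carrier (free_alg \<mu>))"
  proof (rule inj_onI, rule ccontr)
    fix p q assume c: "p \<in> carrier (free_alg \<mu>)" "q \<in> carrier (free_alg \<mu>)"
      and eq: "{a \<in> cube \<mu>. ev \<mu> p a} = {a \<in> cube \<mu>. ev \<mu> q a}" and "p \<noteq> q"
    then obtain h where h: "h \<in> balg_hom (free_alg \<mu>) two" "h p \<noteq> h q"
      using boolean_algebra_on.separating_hom[OF boolean_algebra_on.intro[OF boolean_alg_free_alg]] by blast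
    define a where "a = (\<lambda>\<beta>\<in>{..<\<mu>}. h (gen \<mu> \<beta>))"
    have "a \<in> cube \<mu>" by (simp add: a_def cube_def two_def)
    then have "ev \<mu> p a = ev \<mu> q a"
      using eq by blast
    then show False
      using h c ev_eq_hom[OF h(1), of _ a] by (simp add: a_def)
  qed
qed

lemma finite_lepoll_segment:
  assumes "infinite (UNIV :: 'i::wellorder set)" "finite A"
  obtains \<nu> :: "'i::wellorder" where "A \<lesssim> {..<\<nu>}"
proof -
  \<comment> \<open>One element more than \<open>card A\<close>, because the maximum is not among
    its own predecessors.\<close>
  obtain S :: "'i set" where S: "finite S" "card S = Suc (card A)"
    using infinite_arbitrarily_large[OF assms(1)] by blast
  then have "Max S \<in> S" by (intro Max_in) auto
  then have "card (S - {Max S}) = card A"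
    using S by simp
  then have "A \<lesssim> S - {Max S}"
    using assms(2) S(1) by (simp add: lepoll_iff_card_le)
  moreover have "S - {Max S} \<subseteq> {..<Max S}"
    using S(1) by (auto simp: less_le)
  ultimately show ?thesis
    using that lepoll_trans[OF _ subset_imp_lepoll] by blast
qed

text \<open>With infinitely many generators, counting terms gives the generators themselves as a
  bound. With finitely many, the algebra is finite and fits into a long enough finite stretch of the
  infinite type \<open>'i\<close>.\<close>

lemma pres_alg_bounded:
  fixes X :: "'i::wellorder \<times> ('i bterm set \<times> 'i bterm set) set"
  assumes "infinite (UNIV :: 'i set)"
  shows "\<exists>\<nu>::'i. carrier (pres_alg X) \<lesssim> {..<\<nu>}"
proof -
  have "carrier (pres_alg X) = carrier (free_alg (fst X)) // snd X"
    by (simp add: pres_alg_def quot_def case_prod_beta)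
  then have le: "carrier (pres_alg X) \<lesssim> carrier (free_alg (fst X))"
    by (simp add: quotient_lepoll)
  show ?thesis
  proof (cases "finite {..<fst X}")
    case True
    then obtain \<nu> :: 'i where "carrier (free_alg (fst X)) \<lesssim> {..<\<nu>}"
      using finite_lepoll_segment[OF assms finite_free_alg[OF True]] by auto
    then show ?thesis
      using lepoll_trans[OF le] by blast
  next
    case False
    have "carrier (free_alg (fst X)) \<lesssim> {t. vars t \<subseteq> {..<fst X}}"
      using quotient_lepoll[of "{t. vars t \<subseteq> {..<fst X}}"]
      by (simp add: free_alg_def quot_def term_alg_def)
    then show ?thesis
      using lepoll_trans[OF le lepoll_trans[OF _ terms_lepoll[OF False]]] by blast
  qed
qed

text \<open>\<open>B\<close> is presented on its own elements: indices below \<mu> are sent onto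
  \<open>carrier B\<close>, and \<theta> is the kernel of the resulting homomorphism from the free
  algebra.\<close>

lemma bounded_algebra_presented:
  fixes \<nu> :: "'i::wellorder"
  assumes B: "boolean_alg B" and bound: "carrier B \<lesssim> {..<\<nu>}"
  obtains \<mu> :: 'i and \<theta> e where "is_cardinal \<mu>" "congruence (free_alg \<mu>) \<theta>"
    "e \<in> balg_hom (quot (free_alg \<mu>) \<theta>) B" "bij_betw e (carrier (quot (free_alg \<mu>) \<theta>)) (carrier B)"
proof -
  \<comment> \<open>The least bound is a cardinal: a smaller equipollent segment would be a smaller
    bound.\<close>
  define \<mu> where "\<mu> = (LEAST \<mu>::'i. carrier B \<lesssim> {..<\<mu>})"
  have \<mu>: "carrier B \<lesssim> {..<\<mu>}"
    unfolding \<mu>_def using bound by (rule LeastI)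
  have "\<not> {..<\<beta>} \<approx> {..<\<mu>}" if "\<beta> < \<mu>" for \<beta>
  proof
    assume "{..<\<beta>} \<approx> {..<\<mu>}"
    then have "carrier B \<lesssim> {..<\<beta>}"
      by (rule lepoll_trans[OF \<mu> eqpoll_imp_lepoll[OF eqpoll_sym]])
    then show False
      using not_less_Least that unfolding \<mu>_def by blast
  qed
  then have card: "is_cardinal \<mu>"
    by (simp add: is_cardinal_def)
  obtain f where f: "inj_on f (carrier B)" "f ` carrier B \<subseteq> {..<\<mu>}"
    using \<mu> by (auto simp: lepoll_def)
  \<comment> \<open>A left inverse of \<open>f\<close>; indices outside the image of
    \<open>f\<close> are sent to zero, so that all values lie in \<open>B\<close> and every element
    of \<open>B\<close> is hit.\<close>
  define a where "a \<beta> = (if \<beta> \<in> f ` carrier B then inv_into (carrier B) f \<beta> else bzero B)" for \<beta>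
  have "a \<beta> \<in> carrier B" for \<beta>
    using op_closedD(1)[OF boolean_alg_op_closed[OF B]] by (auto simp: a_def inv_into_into)
  then obtain h where h: "h \<in> balg_hom (free_alg \<mu>) B" "\<And>\<beta>. \<beta> < \<mu> \<Longrightarrow> h (gen \<mu> \<beta>) = a \<beta>"
    using free_hom_exists[OF B, where \<mu> = \<mu> and a = a] by auto
  let ?\<theta> = "ker (free_alg \<mu>) h"
  have \<theta>: "congruence (free_alg \<mu>) ?\<theta>"
    by (rule congruence_ker[OF op_closed_free_alg h(1)])
  let ?e = "factor (free_alg \<mu>) ?\<theta> h"
  have e: "?e \<in> balg_hom (quot (free_alg \<mu>) ?\<theta>) B"
    by (rule factor_hom[OF op_closed_free_alg \<theta> h(1) subset_refl])
  have ec: "?e (?\<theta> `` {p}) = h p" if "p \<in> carrier (free_alg \<mu>)" for p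
    by (rule factor_class[OF op_closed_free_alg \<theta> h(1) subset_refl that])
  have "b \<in> ?e ` carrier (quot (free_alg \<mu>) ?\<theta>)" if "b \<in> carrier B" for b
  proof
    have \<beta>: "f b < \<mu>" using f(2) that by blast
    show "?\<theta> `` {gen \<mu> (f b)} \<in> carrier (quot (free_alg \<mu>) ?\<theta>)"
      by (rule class_in_quot[OF \<theta> gen_in_free_alg[OF \<beta>]])
    show "b = ?e (?\<theta> `` {gen \<mu> (f b)})"
      using that f(1) by (simp add: ec[OF gen_in_free_alg[OF \<beta>]] h(2)[OF \<beta>] a_def)
  qed
  then have "?e ` carrier (quot (free_alg \<mu>) ?\<theta>) = carrier B"
    using balg_homD(1)[OF e] by blast
  moreover have "\<forall>P\<in>carrier (quot (free_alg \<mu>) ?\<theta>).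
      \<forall>Q\<in>carrier (quot (free_alg \<mu>) ?\<theta>). ?e P = ?e Q \<longrightarrow> P = Q"
    unfolding ball_quot[OF \<theta>] by (simp add: ec class_eq_iff[OF \<theta>]) (simp add: ker_def)
  ultimately have "bij_betw ?e (carrier (quot (free_alg \<mu>) ?\<theta>)) (carrier B)"
    by (simp add: bij_betw_def inj_on_def)
  then show ?thesis
    using that card \<theta> e by blast
qed

text \<open>Arrows of \<open>Vp_cat\<close> are by definition homomorphisms between the algebras
  \<open>pres_alg X\<close>, so the content lies in the objects: presented algebras obey the size
  bound, and bounded algebras are isomorphic to presented ones.\<close>

lemma Vp_BA_equivalence:
  assumes "infinite (UNIV :: 'i::wellorder set)"
  shows "\<exists>F G. equivalence
     (Vp_cat :: ('i \<times> ('i bterm set \<times> 'i bterm set) set, 'i bterm set set \<Rightarrow> 'i bterm set set) precat)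
     (BA_cat :: ('i bterm set set balg, 'i bterm set set \<Rightarrow> 'i bterm set set) precat) F G"
proof (rule equivalence_if_essentially_surjective[where F = pres_alg])
  show "category (Vp_cat :: ('i \<times> ('i bterm set \<times> 'i bterm set) set, _) precat)"
    "category (BA_cat :: ('i bterm set set balg, _) precat)"
    by (rule category_Vp_cat category_BA_cat)+
  show "pres_alg X \<in> Ob BA_cat" if "X \<in> Ob Vp_cat"
    for X :: "'i \<times> ('i bterm set \<times> 'i bterm set) set"
    using that boolean_alg_quot[OF _ boolean_alg_free_alg] pres_alg_bounded[OF assms, of X]
    by (auto simp: BA_cat_def Vp_cat_def pres_alg_def)
  fix B :: "'i bterm set set balg" assume "B \<in> Ob BA_cat"
  then obtain \<nu> :: 'i where B: "boolean_alg B" "carrier B \<lesssim> {..<\<nu>}"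
    by (auto simp: BA_cat_def)
  obtain \<mu> :: 'i and \<theta> e where *: "is_cardinal \<mu>" "congruence (free_alg \<mu>) \<theta>"
    "e \<in> balg_hom (quot (free_alg \<mu>) \<theta>) B" "bij_betw e (carrier (quot (free_alg \<mu>) \<theta>)) (carrier B)"
    by (rule bounded_algebra_presented[OF B])
  have "op_closed (quot (free_alg \<mu>) \<theta>)"
    by (rule boolean_alg_op_closed[OF boolean_alg_quot[OF *(2) boolean_alg_free_alg]])
  then obtain k where "k \<in> balg_hom B (quot (free_alg \<mu>) \<theta>)"
      "compose (carrier (quot (free_alg \<mu>) \<theta>)) k e = (\<lambda>x\<in>carrier (quot (free_alg \<mu>) \<theta>). x)"
      "compose (carrier B) e k = (\<lambda>y\<in>carrier B. y)"
    using *(3,4) by (rule bij_hom_inverse)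
  then have "iso_arrow BA_cat (pres_alg (\<mu>, \<theta>)) B e"
    using *(3) by (auto simp: iso_arrow_def BA_cat_def pres_alg_def)
  moreover have "(\<mu>, \<theta>) \<in> Ob Vp_cat"
    using * by (simp add: Vp_cat_def)
  ultimately show "\<exists>X\<in>Ob Vp_cat. \<exists>e. iso_arrow BA_cat (pres_alg X) B e" by blast
qed (simp_all add: Vp_cat_def BA_cat_def)

theorem corollary6p7:
  shows "equivalence
           (closed_cat :: ('i::wellorder \<times> ('i \<Rightarrow> bool) set, ('i \<Rightarrow> bool) \<Rightarrow> 'i \<Rightarrow> bool) precat)
           (op_cat Vp_cat :: ('i \<times> ('i bterm set \<times> 'i bterm set) set,
                              'i bterm set set \<Rightarrow> 'i bterm set set) precat)
           C_functor V_functor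
       \<and> (infinite (UNIV :: 'i set) \<longrightarrow>
           (\<exists>F G. equivalence
             (Vp_cat :: ('i \<times> ('i bterm set \<times> 'i bterm set) set,
                         'i bterm set set \<Rightarrow> 'i bterm set set) precat)
             (BA_cat :: ('i bterm set set balg, 'i bterm set set \<Rightarrow> 'i bterm set set) precat)
             F G))"
  using closed_cat_equivalence Vp_BA_equivalence by blast

end
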